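(* Define $\{A_n\}$, $\{B_n\}$ by $qf_4f_{20}=\sum_{n\ge0}A_nq^n$ and $qf_4^6=\sum_{n\ge0}B_nq^n$. Then \[ \{n: B_n\equiv 0\pmod{25}\}\subsetneqq\{n: A_n\equiv 0\pmod{25}\}. \]
   Context: $f_j:=\prod_{n=1}^{\infty}(1-q^{jn})$. *)

theory Defs
  imports
    "HOL-Analysis.Infinite_Products"
    "HOL-Computational_Algebra.Formal_Power_Series"
    "HOL-Number_Theory.Cong"
begin

text \<open>
  The product is taken in the ring of formal power series over the integers, with \<open>q\<close> rendered as
  \<^const>\<open>fps_X\<close> and convergence in the \<open>q\<close>-adic metric of \<^typ>\<open>int fps\<close>. The factor with
  index \<open>n\<close> (counted from 0) is the mathematical factor \<open>n + 1\<close>. Only \<open>j > 0\<close> is meaningful.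
\<close>

definition euler_f :: "nat \<Rightarrow> int fps" where
  "euler_f j = prodinf (\<lambda>n. 1 - fps_X ^ (j * (n + 1)))"

text \<open>
  The constant \<^const>\<open>prodinf\<close> is a definite description, so we record that the product
  converges for \<open>j > 0\<close>.
\<close>


lemma euler_f_has_prod:
  assumes "j > 0"
  shows "(\<lambda>n. 1 - fps_X ^ (j * (n + 1)) :: int fps) has_prod euler_f j"
proof -
  define g :: "nat \<Rightarrow> int fps" where "g n = 1 - fps_X ^ (j * (n + 1))" for n
  define P where "P n = (\<Prod>i\<le>n. g i)" for n
  have P_Suc: "fps_nth (P (Suc n)) k = fps_nth (P n) k" if "k \<le> n" for n k
  proof -
    have "k < 1 * (Suc n + 1)"
      using that by simp
    also have "\<dots> \<le> j * (Suc n + 1)"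
      using assms by (intro mult_le_mono1) simp
    finally have "fps_nth (P n * fps_X ^ (j * (Suc n + 1))) k = 0"
      by (simp only: fps_X_power_mult_right_nth if_True)
    moreover have "P (Suc n) = P n * g (Suc n)"
      unfolding P_def by (rule prod.atMost_Suc)
    then have "P (Suc n) = P n - P n * fps_X ^ (j * (Suc n + 1))"
      by (simp only: g_def right_diff_distrib mult_1_right)
    ultimately show ?thesis
      by (simp only: fps_sub_nth diff_0_right)
  qed
  have stable: "fps_nth (P n) k = fps_nth (P k) k" if "k \<le> n" for n k
    using that
  proof (induction n rule: dec_induct)
    case base
    show ?case by (rule refl)
  next
    case (step m)
    show ?case
      using P_Suc[OF step.hyps(1)] step.IH by (rule trans)
  qed
  define p where "p = Abs_fps (\<lambda>k. fps_nth (P k) k)"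
  have lim: "P \<longlonglongrightarrow> p"
  proof (rule tendsto_fpsI)
    fix k
    have "fps_nth p k = fps_nth (P k) k"
      by (simp only: p_def fps_nth_Abs_fps)
    then have "\<forall>n\<ge>k. fps_nth (P n) k = fps_nth p k"
      using stable by metis
    then show "\<forall>\<^sub>F n in sequentially. fps_nth (P n) k = fps_nth p k"
      unfolding eventually_sequentially by (rule exI)
  qed
  have g0: "fps_nth (g n) 0 = 1" for n
  proof -
    have "0 \<noteq> j * (n + 1)" using assms by simp
    then show ?thesis
      by (simp only: g_def fps_sub_nth fps_X_power_nth fps_one_nth if_False if_True refl diff_0_right)
  qed
  have nz: "g n \<noteq> 0" for n
    using g0[of n] by (intro notI) simp
  have "fps_nth p 0 = 1"
    using g0[of 0] by (simp add: p_def P_def)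
  then have "p \<noteq> 0" by (intro notI) simp
  have P_eq: "(\<lambda>n. \<Prod>i\<le>n. g (i + 0)) = P"
    by (rule ext) (simp add: P_def)
  from \<open>p \<noteq> 0\<close> have p: "raw_has_prod g 0 p"
    using lim by (simp only: raw_has_prod_def P_eq simp_thms)
  have iff: "g has_prod x \<longleftrightarrow> x = p" for x
  proof
    assume "g has_prod x"
    then have "raw_has_prod g 0 x"
      unfolding has_prod_def using nz by blast
    then have "P \<longlonglongrightarrow> x"
      by (simp only: raw_has_prod_def P_eq)
    then show "x = p"
      using lim by (rule LIMSEQ_unique)
  next
    assume "x = p"
    then show "g has_prod x"
      using p by (simp only: has_prod_def simp_thms)
  qed
  have g_eq: "(\<lambda>n. 1 - fps_X ^ (j * (n + 1))) = g"
    by (rule ext) (simp only: g_def)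
  have "euler_f j = (THE x. g has_prod x)"
    by (simp only: euler_f_def prodinf_def g_eq)
  also have "\<dots> = p"
    by (simp only: iff the_eq_trivial)
  finally have "g has_prod euler_f j"
    by (simp only: iff)
  then show ?thesis
    by (simp only: g_eq)
qed

end

theory Submission
  imports Defs "HOL-Number_Theory.Euler_Criterion"
begin

text \<open>
  Both series are theta series over the Gaussian integers. Let \<open>s\<close> be the character modulo 2 with
  \<open>s(i) = -1\<close>. Jacobi's cube identity gives
  \<open>4 B\<^sub>n = \<Sum> s(z) z\<^sup>2\<close> over the \<open>z\<close> of norm \<open>n\<close>. The factorization of \<open>f\<^sub>1 f\<^sub>5\<close> into the two
  Rogers--Ramanujan theta series gives \<open>4 A\<^sub>n = \<Sum> s(z) L(x + 2 y)\<close> over the \<open>z = x + i y\<close> of norm \<open>n\<close>,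
  where \<open>L\<close> is the quadratic character modulo 5 and \<open>x + 2 y\<close> is the residue of \<open>z\<close> modulo the
  prime \<open>2 - i\<close>. Both summands are completely multiplicative, so \<open>A\<close> and \<open>B\<close> satisfy
  Hecke recursions, and \<open>L(u) \<equiv> u\<^sup>2\<close> makes these agree modulo 5.

  If \<open>p \<equiv> \<plusminus>1 (mod 5)\<close> splits, then \<open>A\<close> and \<open>B\<close> at \<open>p\<^sup>k\<close> are \<open>\<plusminus>(k + 1)\<close> and, since the discriminant
  \<open>-16 a\<^sup>2 b\<^sup>2\<close> is divisible by 25, \<open>(k + 1) c\<^sup>k\<close> modulo 25 with \<open>c\<close> prime to 5. For all other \<open>p\<close>, the
  value of \<open>A\<close> at \<open>p\<^sup>k\<close> is 0 or \<open>\<plusminus>1\<close>. Hence \<open>A\<^sub>n = 0\<close>, or \<open>B\<^sub>n\<close> is modulo 25 a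
  unit times \<open>A\<^sub>n\<close>. The inclusion is strict because \<open>A\<^sub>1\<^sub>3 = 0\<close> and \<open>B\<^sub>1\<^sub>3 = 10\<close>.
\<close>

subsection \<open>Gaussian binomials and the finite triple product\<close>

text \<open>The lower index is an integer so that the recursion needs no boundary cases; values outside \<open>0..m\<close> are 0.\<close>

fun qbin :: "'a::comm_ring_1 \<Rightarrow> nat \<Rightarrow> int \<Rightarrow> 'a" where
  "qbin q 0 j = (if j = 0 then 1 else 0)"
| "qbin q (Suc m) j = qbin q m (j - 1) + q ^ nat j * qbin q m j"

lemma qbin_neg: "j < 0 \<Longrightarrow> qbin q m j = 0"
  by (induction m arbitrary: j) auto

lemma qbin_gt: "j > int m \<Longrightarrow> qbin q m j = 0"
  by (induction m arbitrary: j) auto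

lemma qbin_0_right: "qbin q m 0 = 1"
  by (induction m) (auto simp: qbin_neg)

text \<open>The second q-Pascal rule, where the power of q sits on the other term. Expanding one
  step by the defining rule and one by the induction hypothesis yields the same four terms in either
  order. The triple product needs both rules: this one adjoins a factor in x, the defining one a
  factor in y.\<close>

lemma qbin_Suc':
  "qbin q (Suc m) j = qbin q m j + q ^ nat (int m + 1 - j) * qbin q m (j - 1)"
proof (induction m arbitrary: j)
  case 0
  show ?case by auto
next
  case (Suc m)
  \<comment> \<open>Outside 1 <= j <= m + 1 the truncated exponents need not add up, but there
    \<open>qbin q m (j - 1)\<close> is 0.\<close>
  have e: "q ^ nat j * (q ^ nat (int m + 1 - j) * qbin q m (j - 1))
      = q ^ nat (int m + 2 - j) * (q ^ nat (j - 1) * qbin q m (j - 1))"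
  proof (cases "1 \<le> j \<and> j \<le> int m + 1")
    case True
    then have "nat j + nat (int m + 1 - j) = nat (int m + 2 - j) + nat (j - 1)" by auto
    then show ?thesis by (simp only: mult.assoc[symmetric] power_add[symmetric])
  next
    case False
    then have "j - 1 < 0 \<or> j - 1 > int m" by auto
    then have "qbin q m (j - 1) = 0" using qbin_neg qbin_gt by blast
    then show ?thesis by simp
  qed
  have "qbin q (Suc (Suc m)) j = qbin q (Suc m) (j - 1) + q ^ nat j * qbin q (Suc m) j"
    by simp
  also have "\<dots> = (qbin q m (j - 1) + q ^ nat (int m + 1 - (j - 1)) * qbin q m (j - 1 - 1))
     + q ^ nat j * (qbin q m j + q ^ nat (int m + 1 - j) * qbin q m (j - 1))"
    by (simp only: Suc.IH)
  also have "\<dots> = (qbin q m (j - 1) + q ^ nat j * qbin q m j)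
     + q ^ nat (int m + 2 - j) * (qbin q m (j - 1 - 1) + q ^ nat (j - 1) * qbin q m (j - 1))"
    using e by (simp add: algebra_simps)
  also have "\<dots> = qbin q (Suc m) j + q ^ nat (int (Suc m) + 1 - j) * qbin q (Suc m) (j - 1)"
    by (simp add: algebra_simps)
  finally show ?case .
qed

text \<open>The product formula for Gaussian binomials, cleared of denominators so that it makes
  sense in any commutative ring. For j > m both sides are 0, the right one because its factor with i
  = m is 1 - q^0.\<close>

lemma qbin_mult_qfact:
  "qbin q m (int j) * (\<Prod>i<j. 1 - q ^ Suc i) = (\<Prod>i<j. 1 - q ^ (m - i))"
proof (induction m arbitrary: j)
  case 0
  show ?case
  proof (cases j)
    case (Suc k)
    then show ?thesis by (simp add: prod.lessThan_Suc_shift del: prod.lessThan_Suc)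
  qed simp
next
  case (Suc m)
  show ?case
  proof (cases j)
    case 0
    then show ?thesis using qbin_0_right[of q "Suc m"] by simp
  next
    case (Suc k)
    define F where "F = (\<Prod>i<k. 1 - q ^ (m - i))"
    have F0: "F * q ^ Suc k * q ^ (m - k) = F * q ^ Suc m"
    proof (cases "k \<le> m")
      case True
      then have "Suc k + (m - k) = Suc m" by simp
      then show ?thesis by (metis mult.assoc power_add)
    next
      case False
      then have "F = 0" by (auto simp: F_def intro!: prod_zero bexI[of _ m])
      then show ?thesis by simp
    qed
    have "qbin q (Suc m) (int j) * (\<Prod>i<j. 1 - q ^ Suc i)
      = qbin q m (int k) * (\<Prod>i<k. 1 - q ^ Suc i) * (1 - q ^ Suc k)
        + q ^ Suc k * (qbin q m (int (Suc k)) * (\<Prod>i<Suc k. 1 - q ^ Suc i))"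
      by (simp add: Suc algebra_simps nat_add_distrib)
    also have "\<dots> = F * (1 - q ^ Suc k) + q ^ Suc k * (F * (1 - q ^ (m - k)))"
      using Suc.IH[of k] Suc.IH[of "Suc k"] by (simp add: F_def)
    also have "\<dots> = F * (1 - q ^ Suc m)"
      using F0 by (simp add: algebra_simps)
    also have "\<dots> = (\<Prod>i<j. 1 - q ^ (Suc m - i))"
      by (simp add: Suc F_def prod.lessThan_Suc_shift del: prod.lessThan_Suc)
    finally show ?thesis .
  qed
qed

text \<open>Ramanujan's form of the theta summand: the base is \<open>x y\<close>, so no inverse of the variable is needed.\<close>

definition theta_term :: "'a::comm_ring_1 \<Rightarrow> 'a \<Rightarrow> int \<Rightarrow> 'a" where
  "theta_term x y k = (- 1) ^ nat \<bar>k\<bar> * x ^ nat (k * (k + 1) div 2) * y ^ nat (k * (k - 1) div 2)"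

lemma theta_term_swap: "theta_term x y (- k) = theta_term y x k"
  by (simp add: theta_term_def algebra_simps)

lemma theta_term_Suc:
  assumes "k \<ge> 0"
  shows "theta_term x y (k + 1) = - (theta_term x y k * x ^ nat (k + 1) * y ^ nat k)"
proof -
  define e where "e = k * (k - 1) div 2"
  have "k * (k - 1) \<ge> 0"
    using assms by (cases "k = 0") auto
  then have "e \<ge> 0"
    by (simp add: e_def pos_imp_zdiv_nonneg_iff)
  have e1: "k * (k + 1) div 2 = e + k"
  proof -
    have "k * (k + 1) = k * (k - 1) + k * 2" by (simp add: algebra_simps)
    then show ?thesis by (simp add: e_def)
  qed
  have e2: "(k + 1) * (k + 1 + 1) div 2 = e + k + (k + 1)"
  proof -
    have "(k + 1) * (k + 1 + 1) = k * (k - 1) + (k + (k + 1)) * 2" by (simp add: algebra_simps)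
    then show ?thesis by (simp add: e_def)
  qed
  have "nat (k * (k + 1) div 2) = nat e + nat k"
    "nat ((k + 1) * (k + 1 + 1) div 2) = nat e + nat k + nat (k + 1)"
    "nat ((k + 1) * (k + 1 - 1) div 2) = nat e + nat k" "nat \<bar>k + 1\<bar> = Suc (nat \<bar>k\<bar>)"
    unfolding e1 e2 using e1 assms \<open>e \<ge> 0\<close> by (simp_all add: algebra_simps nat_add_distrib)
  then show ?thesis
    unfolding theta_term_def e_def[symmetric] by (simp only: power_add power_Suc mult_minus1 mult_minus_left mult_minus_right mult_1_left mult_ac)
qed

text \<open>Comparing exponents shows that the power of x y coming from \<open>qbin_Suc'\<close>
  turns the summand at k into the summand at k - 1, up to a factor independent of k. Negative k
  reduce to positive ones by exchanging x and y.\<close>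

lemma theta_term_shift_left:
  assumes "k \<le> int m + 1"
  shows "theta_term x y k * (x * y) ^ nat (int m + 1 - k) = - (x * (x * y) ^ m * theta_term x y (k - 1))"
proof (cases "k \<ge> 1")
  case True
  obtain j where j: "k = int j + 1" using True by (metis add.commute zle_iff_zadd)
  with assms have "j \<le> m" by simp
  then obtain l where l: "m = j + l" using le_Suc_ex by blast
  have n: "nat (1 + int j) = Suc j" by simp
  show ?thesis
    using theta_term_Suc[of "int j" x y] 
    by (simp add: j l power_mult_distrib power_add algebra_simps n)
next
  case False
  define j where "j = nat (- k)"
  have k: "k = - int j" using False by (simp add: j_def)
  have e: "nat (1 + (int j + int m)) = Suc (m + j)" by simp
  have n: "nat (1 + int j) = Suc j" by simp
  have "theta_term x y (k - 1) = theta_term y x (int j + 1)"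
    using theta_term_swap[of x y "int j + 1"] by (simp only: k minus_add_distrib diff_conv_add_uminus)
  moreover have "theta_term x y k = theta_term y x (int j)"
    using theta_term_swap[of x y "int j"] by (simp add: k)
  ultimately show ?thesis
    using theta_term_Suc[of "int j" y x] 
    by (simp add: k e power_mult_distrib power_add algebra_simps n)
qed

lemma theta_term_shift_right:
  assumes "- k \<le> int n + 1"
  shows "theta_term x y k * (x * y) ^ nat (int n + 1 + k) = - (y * (x * y) ^ n * theta_term x y (k + 1))"
proof -
  have "- k - 1 = - (k + 1)" by simp
  then have "theta_term y x (- k - 1) = theta_term x y (k + 1)"
    by (simp only: theta_term_swap)
  then show ?thesis
    using theta_term_shift_left[of "- k" n y x] assms by (simp add: theta_term_swap mult.commute[of y x])
qed

text \<open>Factors are adjoined one at a time. A Pascal rule splits every summand in two; by the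
  shift lemmas the second halves form the old sum, shifted by one and multiplied by - x (x y)^m or -
  y (x y)^n. Boundary terms vanish with their binomials.\<close>

theorem finite_triple_product:
  "(\<Prod>i<m. 1 - x * (x * y) ^ i) * (\<Prod>i<n. 1 - y * (x * y) ^ i)
    = (\<Sum>k\<in>{- int n..int m}. theta_term x y k * qbin (x * y) (m + n) (int n + k))"
proof -
  define P where "P m n = (\<Sum>k\<in>{- int n..int m}. theta_term x y k * qbin (x * y) (m + n) (int n + k))" for m n
  have stepm: "P (Suc m) n = P m n * (1 - x * (x * y) ^ m)" for m n
  proof -
    have "P (Suc m) n = (\<Sum>k\<in>{- int n..int m + 1}. theta_term x y k * qbin (x * y) (m + n) (int n + k)
        + theta_term x y k * (x * y) ^ nat (int m + 1 - k) * qbin (x * y) (m + n) (int n + (k - 1)))"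
      unfolding P_def
      by (intro sum.cong) (auto simp del: qbin.simps simp: qbin_Suc' algebra_simps)
    also have "\<dots> = (\<Sum>k\<in>{- int n..int m + 1}. theta_term x y k * qbin (x * y) (m + n) (int n + k))
        + (\<Sum>k\<in>{- int n..int m + 1}. - (x * (x * y) ^ m * theta_term x y (k - 1) * qbin (x * y) (m + n) (int n + (k - 1))))"
      unfolding sum.distrib[symmetric]
      by (intro sum.cong refl) (simp add: theta_term_shift_left)
    also have "(\<Sum>k\<in>{- int n..int m + 1}. theta_term x y k * qbin (x * y) (m + n) (int n + k)) = P m n"
      unfolding P_def by (intro sum.mono_neutral_right) (auto simp: qbin_gt)
    also have "(\<Sum>k\<in>{- int n..int m + 1}. - (x * (x * y) ^ m * theta_term x y (k - 1) * qbin (x * y) (m + n) (int n + (k - 1))))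
       = (\<Sum>k\<in>{- int n - 1..int m}. - (x * (x * y) ^ m * theta_term x y k * qbin (x * y) (m + n) (int n + k)))"
      by (rule sum.reindex_bij_witness[of _ "\<lambda>k. k + 1" "\<lambda>k. k - 1"]) auto
    also have "\<dots> = (\<Sum>k\<in>{- int n..int m}. - (x * (x * y) ^ m * theta_term x y k * qbin (x * y) (m + n) (int n + k)))"
      by (intro sum.mono_neutral_right) (auto simp: qbin_neg)
    also have "\<dots> = - (x * (x * y) ^ m) * P m n"
      unfolding P_def sum_distrib_left by (intro sum.cong) (auto simp: algebra_simps)
    finally show ?thesis by (simp add: algebra_simps)
  qed
  have stepn: "P m (Suc n) = P m n * (1 - y * (x * y) ^ n)" for m n
  proof -
    have "P m (Suc n) = (\<Sum>k\<in>{- int n - 1..int m}. theta_term x y k * qbin (x * y) (m + n) (int n + k)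
        + theta_term x y k * (x * y) ^ nat (int n + 1 + k) * qbin (x * y) (m + n) (int n + (k + 1)))"
      unfolding P_def
      by (intro sum.cong) (auto simp: algebra_simps)
    also have "\<dots> = (\<Sum>k\<in>{- int n - 1..int m}. theta_term x y k * qbin (x * y) (m + n) (int n + k))
        + (\<Sum>k\<in>{- int n - 1..int m}. - (y * (x * y) ^ n * theta_term x y (k + 1) * qbin (x * y) (m + n) (int n + (k + 1))))"
      unfolding sum.distrib[symmetric]
      by (intro sum.cong refl) (simp add: theta_term_shift_right)
    also have "(\<Sum>k\<in>{- int n - 1..int m}. theta_term x y k * qbin (x * y) (m + n) (int n + k)) = P m n"
      unfolding P_def by (intro sum.mono_neutral_right) (auto simp: qbin_neg)
    also have "(\<Sum>k\<in>{- int n - 1..int m}. - (y * (x * y) ^ n * theta_term x y (k + 1) * qbin (x * y) (m + n) (int n + (k + 1))))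
       = (\<Sum>k\<in>{- int n..int m + 1}. - (y * (x * y) ^ n * theta_term x y k * qbin (x * y) (m + n) (int n + k)))"
      by (rule sum.reindex_bij_witness[of _ "\<lambda>k. k - 1" "\<lambda>k. k + 1"]) auto
    also have "\<dots> = (\<Sum>k\<in>{- int n..int m}. - (y * (x * y) ^ n * theta_term x y k * qbin (x * y) (m + n) (int n + k)))"
      by (intro sum.mono_neutral_right) (auto simp: qbin_gt)
    also have "\<dots> = - (y * (x * y) ^ n) * P m n"
      unfolding P_def sum_distrib_left by (intro sum.cong) (auto simp: algebra_simps)
    finally show ?thesis by (simp add: algebra_simps)
  qed
  have base: "P m 0 = (\<Prod>i<m. 1 - x * (x * y) ^ i)" for m
    by (induction m) (auto simp: stepm, simp add: P_def theta_term_def)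
  have "P m n = (\<Prod>i<m. 1 - x * (x * y) ^ i) * (\<Prod>i<n. 1 - y * (x * y) ^ i)"
    by (induction n) (simp_all add: base stepn mult.assoc)
  then show ?thesis by (simp add: P_def)
qed

subsection \<open>Theta series of Euler products\<close>

text \<open>Divisibility of a difference by a power of \<open>fps_X\<close> serves below as
  congruence modulo that power, so limits of series are handled by ring arithmetic.\<close>

lemma fps_X_power_dvd_iff:
  fixes f :: "'a::comm_ring_1 fps"
  shows "fps_X ^ n dvd f \<longleftrightarrow> (\<forall>i<n. fps_nth f i = 0)"
proof
  assume "\<forall>i<n. fps_nth f i = 0"
  then have "f = fps_X ^ n * fps_shift n f"
    by (intro fps_ext) (simp add: fps_X_power_mult_nth)
  then show "fps_X ^ n dvd f" by (rule dvdI)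
qed (auto simp: fps_X_power_mult_nth)

text \<open>Every factor beyond the first n is 1 modulo the stated power, so all later partial
  products agree with the n-th modulo it. In the q-adic topology each coefficient of the limit is
  attained by some late partial product.\<close>

lemma euler_f_truncation:
  assumes "j > 0"
  shows "fps_X ^ (j * Suc n) dvd euler_f j - (\<Prod>i<n. 1 - fps_X ^ (j * Suc i))"
proof -
  define P :: "nat \<Rightarrow> int fps" where "P n = (\<Prod>i<n. 1 - fps_X ^ (j * Suc i))" for n
  have P_Suc: "P (Suc n) = P n - P n * fps_X ^ (j * Suc n)" for n
    by (simp add: P_def algebra_simps)
  have stable: "fps_X ^ (j * Suc n) dvd P m - P n" if "n \<le> m" for m
    using that
  proof (induction m rule: dec_induct)
    case (step m)
    have "P (Suc m) - P n = (P m - P n) - P m * fps_X ^ (j * Suc m)"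
      by (simp only: P_Suc algebra_simps)
    moreover have "(fps_X :: int fps) ^ (j * Suc n) dvd fps_X ^ (j * Suc m)"
      using step.hyps by (intro le_imp_power_dvd) simp
    ultimately show ?case
      using step.IH by (metis dvd_diff dvd_mult)
  qed simp
  have nz: "1 - fps_X ^ (j * (i + 1)) \<noteq> (0 :: int fps)" for i
  proof -
    have "fps_nth (1 - fps_X ^ (j * (i + 1)) :: int fps) 0 = 1"
      using assms by (simp add: fps_X_power_nth)
    then show ?thesis by (metis fps_zero_nth zero_neq_one)
  qed
  have "raw_has_prod (\<lambda>i. 1 - fps_X ^ (j * (i + 1)) :: int fps) 0 (euler_f j)"
    using euler_f_has_prod[OF assms] nz unfolding has_prod_def by blast
  then have "(\<lambda>m. P (Suc m)) \<longlonglongrightarrow> euler_f j"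
    by (simp add: raw_has_prod_def P_def lessThan_Suc_atMost)
  then have lim: "P \<longlonglongrightarrow> euler_f j"
    by (rule LIMSEQ_imp_Suc)
  show ?thesis
    unfolding fps_X_power_dvd_iff
  proof (intro allI impI)
    fix i assume i: "i < j * Suc n"
    have "\<forall>\<^sub>F m in sequentially. fps_nth (P m) i = fps_nth (euler_f j) i"
      using lim unfolding tendsto_fps_iff by blast
    then obtain m where "m \<ge> n" "fps_nth (P m) i = fps_nth (euler_f j) i"
      unfolding eventually_sequentially by (metis linear)
    moreover have "fps_nth (P m - P n) i = 0"
      using stable[OF \<open>m \<ge> n\<close>] i unfolding fps_X_power_dvd_iff by blast
    ultimately show "fps_nth (euler_f j - (\<Prod>i<n. 1 - fps_X ^ (j * Suc i))) i = 0"
      by (simp add: P_def)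
  qed
qed

lemma dvd_prod_minus_one:
  fixes c :: "'a::comm_ring_1"
  assumes "\<And>i. i \<in> A \<Longrightarrow> c dvd g i - 1"
  shows "c dvd prod g A - 1"
  using assms
proof (induction A rule: infinite_finite_induct)
  case (insert x A)
  have "prod g (insert x A) - 1 = g x * (prod g A - 1) + (g x - 1)"
    using insert.hyps by (simp add: algebra_simps)
  then show ?case using insert by (metis dvd_add dvd_mult insertCI)
qed simp_all

text \<open>The binomial tends to the inverse of \<open>euler_f d\<close> as j and m - j grow. By
  the product formula its product with the first j Euler factors is 1 up to powers above m - j, and
  those factors approximate \<open>euler_f d\<close> up to powers above j.\<close>

lemma euler_f_mult_qbin:
  assumes "d > 0" "j \<le> m"
  shows "fps_X ^ (d * Suc (min j (m - j))) dvd euler_f d * qbin (fps_X ^ d) m (int j) - 1"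
proof -
  let ?Q = "fps_X ^ d :: int fps"
  let ?c = "fps_X ^ (d * Suc (min j (m - j))) :: int fps"
  let ?F = "\<Prod>i<j. 1 - ?Q ^ Suc i"
  have "?c dvd fps_X ^ (d * Suc j)"
    by (intro le_imp_power_dvd mult_le_mono) auto
  then have 1: "?c dvd euler_f d - ?F"
    using euler_f_truncation[OF assms(1), of j] unfolding power_mult by (rule dvd_trans)
  have "?c dvd (\<Prod>i<j. 1 - ?Q ^ (m - i)) - 1"
  proof (rule dvd_prod_minus_one)
    fix i assume "i \<in> {..<j}"
    then have "?c dvd fps_X ^ (d * (m - i))"
      using assms(2) by (intro le_imp_power_dvd mult_le_mono) auto
    then show "?c dvd 1 - ?Q ^ (m - i) - 1"
      by (simp only: power_mult diff_right_commute) simp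
  qed
  then have 2: "?c dvd qbin ?Q m (int j) * ?F - 1"
    by (simp only: qbin_mult_qfact)
  have "euler_f d * qbin ?Q m (int j) - 1
      = qbin ?Q m (int j) * (euler_f d - ?F) + (qbin ?Q m (int j) * ?F - 1)"
    by (simp add: algebra_simps)
  then show ?thesis using 1 2 by (metis dvd_add dvd_mult)
qed

lemma fps_X_power_dvd_mult_error:
  fixes f g :: "int fps"
  assumes "fps_X ^ (d * r) dvd f" "fps_X ^ (d * s) dvd g" "n \<le> r + s" "d > 0"
  shows "fps_X ^ n dvd f * g"
proof -
  have "n \<le> 1 * (r + s)" using assms(3) by simp
  also have "\<dots> \<le> d * (r + s)" using assms(4) by (intro mult_le_mono1) simp
  finally have "(fps_X :: int fps) ^ n dvd fps_X ^ (d * r + d * s)"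
    by (intro le_imp_power_dvd) (simp add: algebra_simps)
  also have "\<dots> dvd f * g"
    unfolding power_add using assms(1,2) by (rule mult_dvd_mono)
  finally show ?thesis .
qed

text \<open>The finite identity with x = q^a, y = q^b and n factors of each kind. For small |k| the
  binomial is close to the inverse of \<open>euler_f d\<close>; for large |k| the theta term itself
  has high order. The two orders always add up to at least n.\<close>

lemma triple_product_limit:
  assumes "d = a + b" "d > 0"
  shows "fps_X ^ n dvd euler_f d * ((\<Prod>i<n. 1 - fps_X ^ (a + d * i)) * (\<Prod>i<n. 1 - fps_X ^ (b + d * i)))
    - (\<Sum>k\<in>{- int n..int n}. theta_term (fps_X ^ a) (fps_X ^ b) k)"
proof -
  let ?\<theta> = "theta_term (fps_X ^ a :: int fps) (fps_X ^ b)"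
  let ?q = "\<lambda>k. euler_f d * qbin (fps_X ^ d) (2 * n) (int n + k) - 1"
  have "(\<Prod>i<n. 1 - fps_X ^ (a + d * i) :: int fps) * (\<Prod>i<n. 1 - fps_X ^ (b + d * i))
      = (\<Sum>k\<in>{- int n..int n}. ?\<theta> k * qbin (fps_X ^ d) (2 * n) (int n + k))"
    using finite_triple_product[of "fps_X ^ a :: int fps" "fps_X ^ b" n n]
    unfolding power_add[symmetric] assms(1)[symmetric] power_mult[symmetric] by (simp add: mult_2)
  then have "euler_f d * ((\<Prod>i<n. 1 - fps_X ^ (a + d * i)) * (\<Prod>i<n. 1 - fps_X ^ (b + d * i)))
      - sum ?\<theta> {- int n..int n} = (\<Sum>k\<in>{- int n..int n}. ?\<theta> k * ?q k)"
    by (simp add: sum_distrib_left sum_subtractf algebra_simps)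
  moreover have "fps_X ^ n dvd ?\<theta> k * ?q k" if k: "k \<in> {- int n..int n}" for k
  proof -
    \<comment> \<open>With t = |k|, the two triangular exponents of the theta term are r and r + t
      in some order, so r bounds both from below.\<close>
    define t where "t = nat \<bar>k\<bar>"
    define r where "r = t * (t - 1) div 2"
    have t: "t \<le> n" using k by (auto simp: t_def)
    have "even (t * (t - 1))" by (cases t) auto
    then have r0: "t * (t - 1) = 2 * r" by (simp add: r_def)
    have kr: "k * (k + 1) = 2 * int r \<and> k * (k - 1) = 2 * int r + 2 * int t
        \<or> k * (k + 1) = 2 * int r + 2 * int t \<and> k * (k - 1) = 2 * int r"
    proof -
      have "2 * int r = int t * (int t - 1)"
        using arg_cong[OF r0, of int] by (cases t) (simp_all add: algebra_simps)
      moreover have "k = int t \<or> k = - int t" by (auto simp: t_def)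
      ultimately show ?thesis by (auto simp: algebra_simps)
    qed
    then have "r \<le> nat (k * (k + 1) div 2)" "r \<le> nat (k * (k - 1) div 2)"
      by auto
    then have "d * r \<le> a * nat (k * (k + 1) div 2) + b * nat (k * (k - 1) div 2)"
      unfolding assms(1) add_mult_distrib by (intro add_mono mult_le_mono) auto
    then have "(fps_X :: int fps) ^ (d * r) dvd fps_X ^ (a * nat (k * (k + 1) div 2) + b * nat (k * (k - 1) div 2))"
      by (rule le_imp_power_dvd)
    then have 1: "fps_X ^ (d * r) dvd ?\<theta> k"
      unfolding theta_term_def power_add power_mult by (simp only: mult.assoc dvd_mult)
    define j where "j = nat (int n + k)"
    have j: "int n + k = int j" "j \<le> 2 * n" and mj: "min j (2 * n - j) = n - t"
      using k by (auto simp: j_def t_def min_def)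
    have 2: "fps_X ^ (d * Suc (n - t)) dvd ?q k"
      using euler_f_mult_qbin[OF assms(2) j(2)] unfolding j(1) mj .
    \<comment> \<open>This bound makes up for the t orders that the binomial estimate loses.\<close>
    have "t - 1 \<le> r"
    proof (cases "t \<ge> 2")
      case True
      then have "2 * (t - 1) \<le> t * (t - 1)" by (intro mult_le_mono1) simp
      then show ?thesis using r0 by linarith
    qed simp
    then have "n \<le> r + Suc (n - t)" using t by simp
    then show ?thesis
      by (rule fps_X_power_dvd_mult_error[OF 1 2 _ assms(2)])
  qed
  ultimately show ?thesis by (metis (no_types, lifting) dvd_sum)
qed

section \<open>Jacobi's identity for the cube of the Euler product\<close>

lemma qbin_fps_const: "qbin (fps_const q) m j = fps_const (qbin q m j)"
  by (induction m arbitrary: j) simp_all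

lemma finite_cube_identity:
  fixes q :: "'a::comm_ring_1"
  shows "(\<Prod>i<n. 1 - q ^ Suc i) ^ 2
    = (\<Sum>k\<in>{- int n..int n + 1}. (- 1) ^ nat \<bar>k\<bar> * of_int (- k) * q ^ nat (k * (k - 1) div 2)
        * qbin q (2 * n + 1) (int n + k))"
proof -
  \<comment> \<open>Take \<open>x = 1 - T\<close>, \<open>y = q / (1 - T)\<close> in the triple product and compare the coefficients of \<open>T\<close>.\<close>
  define x :: "'a fps" where "x = 1 - fps_X"
  define v :: "'a fps" where "v = Abs_fps (\<lambda>_. 1)"
  define y where "y = fps_const q * v"
  have "x * v = 1"
    by (rule fps_ext) (simp add: x_def v_def algebra_simps fps_X_mult_nth)
  then have xy: "x * y = fps_const q"
    by (simp add: y_def mult.left_commute[of x])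
  have x0: "fps_nth x 0 = 1" "fps_nth x 1 = -1"
    by (simp_all add: x_def)
  have v0: "fps_nth v 0 = 1" "fps_nth v 1 = 1"
    by (simp_all add: v_def)
  have xp: "fps_nth (x ^ a) 0 = 1" "fps_nth (x ^ a) 1 = - of_nat a" for a
    using x0 by (induction a) (simp_all add: fps_mult_nth_1)
  have vp: "fps_nth (v ^ a) 0 = 1" "fps_nth (v ^ a) 1 = of_nat a" for a
    using v0 by (induction a) (simp_all add: fps_mult_nth_1)
  have theta: "fps_nth (theta_term x y k) 1
      = (- 1) ^ nat \<bar>k\<bar> * of_int (- k) * q ^ nat (k * (k - 1) div 2)" for k
  proof -
    define a where "a = nat (k * (k + 1) div 2)"
    define b where "b = nat (k * (k - 1) div 2)"
    have "k * (k + 1) \<ge> 0"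
      by (cases "k \<ge> 0") (auto simp: zero_le_mult_iff)
    moreover have "k * (k - 1) \<ge> 0"
      by (cases "k \<ge> 1") (auto simp: zero_le_mult_iff)
    moreover have "k * (k + 1) = k * (k - 1) + k * 2"
      by (simp add: algebra_simps)
    ultimately have "int b - int a = - k"
      unfolding a_def b_def by simp
    then have "of_nat b - of_nat a = (of_int (- k) :: 'a)"
      by (metis of_int_diff of_int_of_nat_eq)
    moreover have "fps_const ((- 1) ^ nat \<bar>k\<bar> * q ^ b) = (- 1) ^ nat \<bar>k\<bar> * fps_const q ^ b"
      by (cases "even (nat \<bar>k\<bar>)") (simp_all add: fps_const_power)
    then have "theta_term x y k = fps_const ((- 1) ^ nat \<bar>k\<bar> * q ^ b) * (x ^ a * v ^ b)"
      by (simp only: theta_term_def a_def[symmetric] b_def[symmetric] y_def power_mult_distrib mult_ac)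
    then have "fps_nth (theta_term x y k) 1 = ((- 1) ^ nat \<bar>k\<bar> * q ^ b) * (of_nat b - of_nat a)"
      by (simp only: fps_mult_left_const_nth fps_mult_nth_1 xp vp) simp
    ultimately show ?thesis
      by (simp only: b_def[symmetric] mult_ac)
  qed
  \<comment> \<open>Taking one more factor in x than in y is deliberate: the factor with i = 0 is 1
    - x = T, so the coefficient of T in the product is the constant term of the remaining
    factors.\<close>
  have "(\<Prod>i<Suc n. 1 - x * (x * y) ^ i) * (\<Prod>i<n. 1 - y * (x * y) ^ i)
      = fps_X * ((\<Prod>i<n. 1 - x * fps_const q ^ Suc i) * (\<Prod>i<n. 1 - y * fps_const q ^ i))"
    unfolding prod.lessThan_Suc_shift xy by (simp add: x_def mult.assoc)
  then have "fps_nth ((\<Prod>i<Suc n. 1 - x * (x * y) ^ i) * (\<Prod>i<n. 1 - y * (x * y) ^ i)) 1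
      = fps_nth ((\<Prod>i<n. 1 - x * fps_const q ^ Suc i) * (\<Prod>i<n. 1 - y * fps_const q ^ i)) 0"
    by (simp add: fps_X_mult_nth)
  also have "\<dots> = (\<Prod>i<n. 1 - q ^ Suc i) ^ 2"
  proof -
    have p0: "fps_nth (prod f A) 0 = (\<Prod>i\<in>A. fps_nth (f i) 0)" for f :: "nat \<Rightarrow> 'a fps" and A
      by (induction A rule: infinite_finite_induct) simp_all
    show ?thesis
      by (simp add: p0 x0 v0 y_def fps_const_power power2_eq_square)
  qed
  finally have "(\<Prod>i<n. 1 - q ^ Suc i) ^ 2
      = fps_nth (\<Sum>k\<in>{- int n..int (Suc n)}. theta_term x y k * qbin (x * y) (Suc n + n) (int n + k)) 1"
    by (simp only: finite_triple_product)
  also have "\<dots> = (\<Sum>k\<in>{- int n..int n + 1}. fps_nth (theta_term x y k) 1 * qbin q (2 * n + 1) (int n + k))"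
  proof -
    have "Suc n + n = 2 * n + 1" "int (Suc n) = int n + 1" by simp_all
    then show ?thesis
      by (simp only: fps_sum_nth xy qbin_fps_const fps_mult_right_const_nth)
  qed
  finally show ?thesis
    by (simp only: theta)
qed

text \<open>Two of the three Euler products come from the square in
  \<open>finite_cube_identity\<close>; the third cancels the binomials up to an error, estimated as
  in \<open>triple_product_limit\<close>.\<close>

lemma cube_limit:
  assumes "d > 0"
  shows "fps_X ^ n dvd euler_f d ^ 3
    - (\<Sum>k\<in>{- int n..int n + 1}. of_int ((- 1) ^ nat \<bar>k\<bar> * (- k)) * fps_X ^ (d * nat (k * (k - 1) div 2)))"
proof -
  let ?c = "\<lambda>k. of_int ((- 1) ^ nat \<bar>k\<bar> * (- k)) * fps_X ^ (d * nat (k * (k - 1) div 2)) :: int fps"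
  let ?q = "\<lambda>k. euler_f d * qbin (fps_X ^ d) (2 * n + 1) (int n + k) - 1"
  let ?P = "\<Prod>i<n. 1 - fps_X ^ (d * Suc i) :: int fps"
  have "?P ^ 2 = (\<Sum>k\<in>{- int n..int n + 1}. ?c k * qbin (fps_X ^ d) (2 * n + 1) (int n + k))"
    using finite_cube_identity[of "fps_X ^ d :: int fps" n]
    unfolding power_mult by (simp add: mult_ac del: qbin.simps)
  then have "euler_f d * ?P ^ 2 = (\<Sum>k\<in>{- int n..int n + 1}. euler_f d * (?c k * qbin (fps_X ^ d) (2 * n + 1) (int n + k)))"
    by (simp only: sum_distrib_left)
  then have "euler_f d * ?P ^ 2 - sum ?c {- int n..int n + 1} = (\<Sum>k\<in>{- int n..int n + 1}. ?c k * ?q k)"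
    by (simp only: sum_subtractf[symmetric] right_diff_distrib mult_1_right mult.left_commute)
  moreover have "fps_X ^ n dvd ?c k * ?q k" if k: "k \<in> {- int n..int n + 1}" for k
  proof -
    define r where "r = nat (k * (k - 1) div 2)"
    have 1: "fps_X ^ (d * r) dvd ?c k"
      by (simp add: r_def)
    define j where "j = nat (int n + k)"
    have j: "int n + k = int j" "j \<le> 2 * n + 1"
      using k by (auto simp: j_def)
    have 2: "fps_X ^ (d * Suc (min j (2 * n + 1 - j))) dvd ?q k"
      using euler_f_mult_qbin[OF assms j(2)] unfolding j(1) .
    \<comment> \<open>The index range is symmetric under k -> 1 - k. The two bounds treat its two
      ends, where the binomial estimate is weak.\<close>
    have "k * (k - 1) \<ge> 2 * (k - 1)"
    proof -
      have "(k - 1) * (k - 2) \<ge> 0" by (cases "k \<ge> 2") (auto simp: zero_le_mult_iff)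
      then show ?thesis by (simp add: algebra_simps)
    qed
    moreover have "k * (k - 1) \<ge> 2 * (- k)"
    proof -
      have "k * (k + 1) \<ge> 0" by (cases "k \<ge> 0") (auto simp: zero_le_mult_iff)
      then show ?thesis by (simp add: algebra_simps)
    qed
    ultimately have "k - 1 \<le> int r" "- k \<le> int r"
      by (auto simp: r_def)
    then have "n \<le> r + Suc (min j (2 * n + 1 - j))"
      using j by (auto simp: min_def)
    then show ?thesis
      by (rule fps_X_power_dvd_mult_error[OF 1 2 _ assms])
  qed
  ultimately have 1: "fps_X ^ n dvd euler_f d * ?P ^ 2 - sum ?c {- int n..int n + 1}"
    by (metis (no_types, lifting) dvd_sum)
  have "fps_X ^ n dvd euler_f d - ?P"
    using euler_f_truncation[OF assms, of n]
    by (rule dvd_trans[rotated]) (use assms in \<open>auto intro!: le_imp_power_dvd simp: trans_le_add2\<close>)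
  moreover have "euler_f d ^ 3 - sum ?c {- int n..int n + 1}
     = euler_f d * (euler_f d + ?P) * (euler_f d - ?P) + (euler_f d * ?P ^ 2 - sum ?c {- int n..int n + 1})"
    by (simp add: algebra_simps power2_eq_square power3_eq_cube)
  ultimately show ?thesis using 1 by (metis (no_types, lifting) dvd_add dvd_mult)
qed

subsection \<open>Coefficients as sums over index pairs\<close>

lemma minus_one_power_nat_abs: "(- 1) ^ nat \<bar>k\<bar> = (if even k then 1 else - 1 :: int)"
  by (cases "even k") (auto simp: even_nat_iff)

lemma fps_nth_theta_product:
  fixes c d :: "int \<Rightarrow> int"
  assumes "finite I" "finite J"
  shows "fps_nth (fps_X * ((\<Sum>k\<in>I. of_int (c k) * fps_X ^ e k) * (\<Sum>l\<in>J. of_int (d l) * fps_X ^ f l))) n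
    = (\<Sum>(k, l)\<in>{(k, l). k \<in> I \<and> l \<in> J \<and> 1 + e k + f l = n}. c k * d l)"
proof -
  have const: "fps_const (i * j) = (of_int i * of_int j :: int fps)" for i j
    using fps_of_int[of "i * j", where 'a = int] by simp
  have "fps_X * ((\<Sum>k\<in>I. of_int (c k) * fps_X ^ e k) * (\<Sum>l\<in>J. of_int (d l) * fps_X ^ f l))
      = (\<Sum>(k, l)\<in>I \<times> J. fps_const (c k * d l) * fps_X ^ (1 + e k + f l))"
    unfolding sum_product sum.cartesian_product unfolding sum_distrib_left
    by (intro sum.cong refl) (simp only: case_prod_unfold const power_add power_one_right mult_ac)
  then have "fps_nth (fps_X * ((\<Sum>k\<in>I. of_int (c k) * fps_X ^ e k) * (\<Sum>l\<in>J. of_int (d l) * fps_X ^ f l))) n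
      = (\<Sum>(k, l)\<in>I \<times> J. if 1 + e k + f l = n then c k * d l else 0)"
    by (simp only: fps_sum_nth) (intro sum.cong refl, auto simp: fps_X_power_nth)
  also have "\<dots> = (\<Sum>(k, l)\<in>{(k, l). k \<in> I \<and> l \<in> J \<and> 1 + e k + f l = n}. c k * d l)"
    using assms by (intro sum.mono_neutral_cong_right) (auto split: if_splits)
  finally show ?thesis .
qed

lemma fps_nth_eq_of_dvd:
  fixes f g :: "'a::comm_ring_1 fps"
  assumes "fps_X ^ Suc n dvd f - g"
  shows "fps_nth (fps_X * f) n = fps_nth (fps_X * g) n"
proof -
  have "fps_X ^ Suc n dvd fps_X * (f - g)"
    using assms by (rule dvd_mult)
  then have "fps_nth (fps_X * (f - g)) n = 0"
    unfolding fps_X_power_dvd_iff by blast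
  then show ?thesis by (simp add: right_diff_distrib)
qed

lemma nat_triangular:
  fixes k :: int
  shows "2 * int (nat (k * (k + 1) div 2)) = k * (k + 1)" "2 * int (nat (k * (k - 1) div 2)) = k * (k - 1)"
proof -
  have "k * (k + 1) \<ge> 0" "k * (k - 1) \<ge> 0"
    by (cases "k \<ge> 1"; auto simp: zero_le_mult_iff)+
  moreover have "even (k * (k + 1))" "even (k * (k - 1))"
    by auto
  ultimately show "2 * int (nat (k * (k + 1) div 2)) = k * (k + 1)"
    "2 * int (nat (k * (k - 1) div 2)) = k * (k - 1)" by auto
qed

lemma dvd_diff_mult:
  fixes c :: "'a::comm_ring_1"
  assumes "c dvd a - a'" "c dvd b - b'"
  shows "c dvd a * b - a' * b'"
proof -
  have "a * b - a' * b' = (a - a') * b + a' * (b - b')"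
    by (simp add: algebra_simps)
  then show ?thesis using assms by simp
qed

lemma euler_f_truncation':
  assumes "j > 0" "n \<le> m"
  shows "fps_X ^ n dvd euler_f j - (\<Prod>i<m. 1 - fps_X ^ (j * Suc i))"
proof -
  have "n \<le> 1 * Suc m" using assms by simp
  also have "\<dots> \<le> j * Suc m" using assms by (intro mult_le_mono1) simp
  finally have "(fps_X :: int fps) ^ n dvd fps_X ^ (j * Suc m)"
    by (rule le_imp_power_dvd)
  then show ?thesis using euler_f_truncation[OF assms(1)] by (rule dvd_trans)
qed

text \<open>The exponents 4 i are sorted by their residue modulo 20. The residues 4, 16 and 8, 12
  pair up, and the residue 0 supplies a second copy of \<open>euler_f 20\<close>, so each pair gets
  the Euler factor that its triple product requires.\<close>

lemma euler_f_4_20_theta: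
  "fps_X ^ n dvd euler_f 4 * euler_f 20
    - (\<Sum>k\<in>{- int n..int n}. theta_term (fps_X ^ 4) (fps_X ^ 16) k)
      * (\<Sum>k\<in>{- int n..int n}. theta_term (fps_X ^ 8) (fps_X ^ 12) k)"
proof -
  define p where "p a = (\<Prod>i<n. 1 - fps_X ^ (a + 20 * i) :: int fps)" for a :: nat
  define g where "g = (\<Prod>i<5 * n. 1 - fps_X ^ (4 * Suc i) :: int fps)"
  have g: "g = (p 4 * p 16) * (p 8 * p 12) * p 20"
    unfolding g_def p_def prod.distrib[symmetric]
  proof (induction n)
    case (Suc n)
    have "5 * Suc n = Suc (Suc (Suc (Suc (Suc (5 * n)))))" by simp
    moreover have "4 * Suc (5 * n) = 4 + 20 * n" "4 * Suc (Suc (5 * n)) = 8 + 20 * n"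
      "4 * Suc (Suc (Suc (5 * n))) = 12 + 20 * n" "4 * Suc (Suc (Suc (Suc (5 * n)))) = 16 + 20 * n"
      "4 * Suc (Suc (Suc (Suc (Suc (5 * n))))) = 20 + 20 * n"
      by simp_all
    ultimately have step: "(\<Prod>i<5 * Suc n. 1 - fps_X ^ (4 * Suc i) :: int fps) = (\<Prod>i<5 * n. 1 - fps_X ^ (4 * Suc i))
        * ((1 - fps_X ^ (4 + 20 * n)) * ((1 - fps_X ^ (8 + 20 * n)) * ((1 - fps_X ^ (12 + 20 * n))
        * ((1 - fps_X ^ (16 + 20 * n)) * (1 - fps_X ^ (20 + 20 * n))))))"
      by (simp only: prod.lessThan_Suc mult.assoc)
    have ac: "a * (b * (c * (d * e))) = a * d * (b * c) * e" for a b c d e :: "int fps"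
      by (simp add: algebra_simps)
    show ?case
      unfolding step Suc.IH prod.lessThan_Suc by (rule arg_cong[OF ac])
  qed simp
  have 1: "fps_X ^ n dvd euler_f 4 - g"
    unfolding g_def by (rule euler_f_truncation') auto
  have "p 20 = (\<Prod>i<n. 1 - fps_X ^ (20 * Suc i))"
    by (simp add: p_def)
  then have 2: "fps_X ^ n dvd p 20 - euler_f 20"
    using dvd_minus_iff[THEN iffD2, OF euler_f_truncation'[of 20 n n]] by simp
  have 3: "fps_X ^ n dvd (euler_f 20 * (p 4 * p 16)) * (euler_f 20 * (p 8 * p 12))
    - (\<Sum>k\<in>{- int n..int n}. theta_term (fps_X ^ 4) (fps_X ^ 16) k)
      * (\<Sum>k\<in>{- int n..int n}. theta_term (fps_X ^ 8) (fps_X ^ 12) k)"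
    unfolding p_def by (intro dvd_diff_mult triple_product_limit) simp_all
  have "euler_f 4 * euler_f 20 - T = euler_f 20 * (euler_f 4 - g)
     + euler_f 20 * (p 4 * p 16) * (p 8 * p 12) * (p 20 - euler_f 20)
     + ((euler_f 20 * (p 4 * p 16)) * (euler_f 20 * (p 8 * p 12)) - T)" for T
    by (simp add: g algebra_simps)
  then show ?thesis using 1 2 3 by (metis (no_types, lifting) dvd_add dvd_mult)
qed

lemma theta_term_fps:
  "theta_term (fps_X ^ a :: int fps) (fps_X ^ b) k
    = of_int ((- 1) ^ nat \<bar>k\<bar>) * fps_X ^ (a * nat (k * (k + 1) div 2) + b * nat (k * (k - 1) div 2))"
  by (simp add: theta_term_def power_add power_mult mult.assoc)

lemma abs_le_square: "\<bar>k\<bar> \<le> k * k" for k :: int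
proof (cases "k = 0")
  case False
  then have "\<bar>k\<bar> * 1 \<le> \<bar>k\<bar> * \<bar>k\<bar>"
    by (intro mult_left_mono) auto
  then show ?thesis by (simp only: abs_mult_self_eq mult_1_right)
qed simp

lemma fps_nth_euler_f_4_20:
  "fps_nth (fps_X * euler_f 4 * euler_f 20) n
    = (\<Sum>(k, l)\<in>{(k, l). 10 * k * k - 6 * k + 10 * l * l - 2 * l + 1 = int n}. if even (k + l) then 1 else - 1)"
proof -
  let ?N = "int (Suc n)"
  let ?e = "\<lambda>a b k. a * nat (k * (k + 1) div 2) + b * nat (k * (k - 1) div 2)"
  have e: "int (?e 4 16 k) = 10 * k * k - 6 * k" "int (?e 8 12 k) = 10 * k * k - 2 * k" for k
    using nat_triangular[of k] by (simp_all add: algebra_simps)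
  have set: "(k \<in> {- ?N..?N} \<and> l \<in> {- ?N..?N} \<and> 1 + ?e 4 16 k + ?e 8 12 l = n)
      \<longleftrightarrow> 10 * k * k - 6 * k + 10 * l * l - 2 * l + 1 = int n" (is "?L \<longleftrightarrow> ?R") for k l
  proof -
    have *: "1 + ?e 4 16 k + ?e 8 12 l = n \<longleftrightarrow> ?R"
      using e(1)[of k] e(2)[of l] by (intro iffI; linarith)
    \<comment> \<open>Every integer solution already lies in the truncation box, so the sum may run
      over all solutions.\<close>
    have "k \<in> {- ?N..?N} \<and> l \<in> {- ?N..?N}" if ?R
      using that abs_le_square[of k] abs_le_square[of l] by (auto simp: mult.assoc abs_if split: if_splits)
    then show ?thesis using * by blast
  qed
  have "fps_nth (fps_X * euler_f 4 * euler_f 20) n = fps_nth (fps_X * (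
      (\<Sum>k\<in>{- ?N..?N}. theta_term (fps_X ^ 4) (fps_X ^ 16) k)
      * (\<Sum>k\<in>{- ?N..?N}. theta_term (fps_X ^ 8) (fps_X ^ 12) k))) n"
    unfolding mult.assoc by (intro fps_nth_eq_of_dvd euler_f_4_20_theta)
  also have "\<dots> = (\<Sum>(k, l)\<in>{(k, l). k \<in> {- ?N..?N} \<and> l \<in> {- ?N..?N} \<and> 1 + ?e 4 16 k + ?e 8 12 l = n}.
      (- 1) ^ nat \<bar>k\<bar> * (- 1) ^ nat \<bar>l\<bar>)"
    unfolding theta_term_fps by (rule fps_nth_theta_product) auto
  also have "\<dots> = (\<Sum>(k, l)\<in>{(k, l). 10 * k * k - 6 * k + 10 * l * l - 2 * l + 1 = int n}. if even (k + l) then 1 else - 1)"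
    unfolding set minus_one_power_nat_abs by (intro sum.cong) auto
  finally show ?thesis .
qed

lemma fps_nth_euler_f_4_power_6:
  "fps_nth (fps_X * euler_f 4 ^ 6) n
    = (\<Sum>(k, l)\<in>{(k, l). 2 * k * (k - 1) + 2 * l * (l - 1) + 1 = int n}. (if even (k + l) then 1 else - 1) * (k * l))"
proof -
  let ?N = "int (Suc n)"
  let ?e = "\<lambda>k. 4 * nat (k * (k - 1) div 2)"
  have e: "int (?e k) = 2 * k * (k - 1)" for k
    using nat_triangular[of k] by (simp add: algebra_simps)
  have set: "(k \<in> {- ?N..?N + 1} \<and> l \<in> {- ?N..?N + 1} \<and> 1 + ?e k + ?e l = n)
      \<longleftrightarrow> 2 * k * (k - 1) + 2 * l * (l - 1) + 1 = int n" (is "?L \<longleftrightarrow> ?R") for k l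
  proof -
    have *: "1 + ?e k + ?e l = n \<longleftrightarrow> ?R"
      using e[of k] e[of l] by (intro iffI; linarith)
    have "k \<in> {- ?N..?N + 1} \<and> l \<in> {- ?N..?N + 1}" if ?R
      using that abs_le_square[of "k - 1"] abs_le_square[of "l - 1"] abs_le_square[of k] abs_le_square[of l]
      by (auto simp: algebra_simps abs_if split: if_splits)
    then show ?thesis using * by blast
  qed
  let ?C = "\<Sum>k\<in>{- ?N..?N + 1}. of_int ((- 1) ^ nat \<bar>k\<bar> * (- k)) * fps_X ^ ?e k :: int fps"
  have "euler_f 4 ^ 6 = euler_f 4 ^ 3 * euler_f 4 ^ 3"
    by (simp flip: power_add)
  then have "fps_nth (fps_X * euler_f 4 ^ 6) n = fps_nth (fps_X * (?C * ?C)) n"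
    by (simp only:) (intro fps_nth_eq_of_dvd dvd_diff_mult cube_limit; simp)
  also have "\<dots> = (\<Sum>(k, l)\<in>{(k, l). k \<in> {- ?N..?N + 1} \<and> l \<in> {- ?N..?N + 1} \<and> 1 + ?e k + ?e l = n}.
      ((- 1) ^ nat \<bar>k\<bar> * (- k)) * ((- 1) ^ nat \<bar>l\<bar> * (- l)))"
    by (rule fps_nth_theta_product) auto
  also have "\<dots> = (\<Sum>(k, l)\<in>{(k, l). 2 * k * (k - 1) + 2 * l * (l - 1) + 1 = int n}.
      (if even (k + l) then 1 else - 1) * (k * l))"
    unfolding set minus_one_power_nat_abs by (intro sum.cong) auto
  finally show ?thesis .
qed

subsection \<open>Characters on the Gaussian integers\<close>

definition lattice_points :: "nat \<Rightarrow> (int \<times> int) set" where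
  "lattice_points n = {(x, y). x * x + y * y = int n}"

fun gmult :: "int \<times> int \<Rightarrow> int \<times> int \<Rightarrow> int \<times> int" where
  "gmult (a, b) (c, d) = (a * c - b * d, a * d + b * c)"

text \<open>The character s modulo 2, extended by 0: a Gaussian integer of odd norm is congruent to
  1 or to i modulo 2, according to the parity of y. A pair (x, y) stands for x + i y
  throughout.\<close>

fun gsign :: "int \<times> int \<Rightarrow> int" where
  "gsign (x, y) = (if even (x + y) then 0 else if even y then 1 else - 1)"

definition leg5 :: "int \<Rightarrow> int" where
  "leg5 z = (if z mod 5 = 0 then 0 else if z mod 5 = 1 \<or> z mod 5 = 4 then 1 else - 1)"

text \<open>Modulo 2 - i the unit i becomes 2, so x + 2 y is the residue of x + i y in the field
  with five elements.\<close>

fun charA :: "int \<times> int \<Rightarrow> int" where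
  "charA (x, y) = gsign (x, y) * leg5 (x + 2 * y)"

fun charB :: "int \<times> int \<Rightarrow> complex" where
  "charB (x, y) = of_int (gsign (x, y)) * (Complex (of_int x) (of_int y)) ^ 2"

lemma finite_lattice_points: "finite (lattice_points n)"
proof (rule finite_subset)
  show "lattice_points n \<subseteq> {- int n..int n} \<times> {- int n..int n}"
  proof
    fix z assume "z \<in> lattice_points n"
    then show "z \<in> {- int n..int n} \<times> {- int n..int n}"
      using abs_le_square[of "fst z"] abs_le_square[of "snd z"]
      by (auto simp: lattice_points_def)
  qed
qed simp

lemma mod_5_cases: "m mod 5 = 0 \<or> m mod 5 = 1 \<or> m mod 5 = 2 \<or> m mod 5 = 3 \<or> m mod 5 = 4"
  for m :: int
  by presburger

text \<open>Modulo 5 the number x - 3 y equals x + 2 y, and its parity is that of x + y. This makes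
  the index l = (x - 3 y + 1) / 10 integral when the index pair is recovered from the lattice
  point.\<close>

lemma ten_dvd:
  fixes x y :: int
  assumes "odd (x + y)" "(x + 2 * y) mod 5 = 4"
  shows "10 dvd x - 3 * y + 1"
proof -
  obtain m where "x + 2 * y = 5 * m + 4"
    using assms(2) by (metis mult_div_mod_eq)
  then have x: "x = 5 * m + 4 - 2 * y" by simp
  have "even (m - y + 1)" using assms(1) by (simp add: x)
  then obtain l where "m - y + 1 = 2 * l" by (elim evenE)
  then have "x - 3 * y + 1 = 10 * l" by (simp add: x)
  then show ?thesis by simp
qed

lemma coeff_A_lattice:
  "4 * fps_nth (fps_X * euler_f 4 * euler_f 20) n = sum charA (lattice_points n)"
proof -
  define C where "C r = {(x, y). (x, y) \<in> lattice_points n \<and> odd (x + y) \<and> (x + 2 * y) mod 5 = r}" for r :: int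
  \<comment> \<open>\<open>10 l - 1 + (10 k - 3) i = (1 + 3 i) (x + i y)\<close>, so the index pairs pick one associate of each
    Gaussian integer prime to \<open>2 - i\<close>.\<close>
  have C4: "fps_nth (fps_X * euler_f 4 * euler_f 20) n = sum gsign (C 4)"
    unfolding fps_nth_euler_f_4_20
  proof (rule sum.reindex_bij_witness[of _ "\<lambda>(x, y). ((3 * x + y + 3) div 10, (x - 3 * y + 1) div 10)"
        "\<lambda>(k, l). (l + 3 * k - 1, k - 3 * l)"], goal_cases)
    case (3 z)
    then obtain x y where z: "z = (x, y)" and xy: "odd (x + y)" "(x + 2 * y) mod 5 = 4"
      by (auto simp: C_def)
    have "10 dvd x - 3 * y + 1" using xy(1,2) by (rule ten_dvd)
    then obtain l where "x - 3 * y + 1 = 10 * l" ..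
    then have x: "x = 10 * l + 3 * y - 1" by simp
    have "3 * x + y + 3 = (3 * l + y) * 10" "x - 3 * y + 1 = l * 10"
      by (simp_all add: x)
    then have "(3 * x + y + 3) div 10 = 3 * l + y" "(x - 3 * y + 1) div 10 = l"
      by simp_all
    then show ?case by (simp add: z x)
  next
    case (4 z)
    then obtain x y where z: "z = (x, y)" and xy: "odd (x + y)" "(x + 2 * y) mod 5 = 4" "x * x + y * y = int n"
      by (auto simp: C_def lattice_points_def)
    have "10 dvd x - 3 * y + 1" using xy(1,2) by (rule ten_dvd)
    then obtain l where "x - 3 * y + 1 = 10 * l" ..
    then have x: "x = 10 * l + 3 * y - 1" by simp
    show ?case using xy(3) by (simp add: z x algebra_simps)
  next
    case (2 z)
    then obtain k l where z: "z = (k, l)" and kl: "10 * k * k - 6 * k + 10 * l * l - 2 * l + 1 = int n"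
      by auto
    have "l + 3 * k - 1 + 2 * (k - 3 * l) = 5 * (k - l) - 1" by simp
    then have "(l + 3 * k - 1 + 2 * (k - 3 * l)) mod 5 = 4" by presburger
    then show ?case using kl by (auto simp: z C_def lattice_points_def algebra_simps)
  qed auto
  have c: "(- x - 2 * y) mod 5 = 1 \<longleftrightarrow> (x + 2 * y) mod 5 = 4" "(- x - 2 * y) mod 5 = 4 \<longleftrightarrow> (x + 2 * y) mod 5 = 1"
    "(y - 2 * x) mod 5 = 4 \<longleftrightarrow> (x + 2 * y) mod 5 = 3" "(y - 2 * x) mod 5 = 1 \<longleftrightarrow> (x + 2 * y) mod 5 = 2"
    "(y - 2 * x) mod 5 = 2 \<longleftrightarrow> (x + 2 * y) mod 5 = 4" "(y - 2 * x) mod 5 = 3 \<longleftrightarrow> (x + 2 * y) mod 5 = 1"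
    "(2 * x - y) mod 5 = 2 \<longleftrightarrow> (x + 2 * y) mod 5 = 1" "(2 * x - y) mod 5 = 3 \<longleftrightarrow> (x + 2 * y) mod 5 = 4" for x y :: int
  proof -
    have e: "- x - 2 * y = 4 * (x + 2 * y) + 5 * - (x + 2 * y)" "y - 2 * x = 3 * (x + 2 * y) + 5 * - (x + y)"
      "2 * x - y = 2 * (x + 2 * y) + 5 * - y"
      by simp_all
    have r: "(j * (x + 2 * y) + 5 * w) mod 5 = (j * ((x + 2 * y) mod 5)) mod 5" for j w
      by (simp add: mod_mult_right_eq)
    show "(- x - 2 * y) mod 5 = 1 \<longleftrightarrow> (x + 2 * y) mod 5 = 4" "(- x - 2 * y) mod 5 = 4 \<longleftrightarrow> (x + 2 * y) mod 5 = 1"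
      "(y - 2 * x) mod 5 = 4 \<longleftrightarrow> (x + 2 * y) mod 5 = 3" "(y - 2 * x) mod 5 = 1 \<longleftrightarrow> (x + 2 * y) mod 5 = 2"
      "(y - 2 * x) mod 5 = 2 \<longleftrightarrow> (x + 2 * y) mod 5 = 4" "(y - 2 * x) mod 5 = 3 \<longleftrightarrow> (x + 2 * y) mod 5 = 1"
    "(2 * x - y) mod 5 = 2 \<longleftrightarrow> (x + 2 * y) mod 5 = 1" "(2 * x - y) mod 5 = 3 \<longleftrightarrow> (x + 2 * y) mod 5 = 4"
      unfolding e r using mod_5_cases[of "x + 2 * y"] by (elim disjE; simp)+
  qed
  \<comment> \<open>Multiplication by the units -1 and i permutes the nonzero classes modulo 2 - i.
    Multiplication by i reverses \<open>gsign\<close> and, as 2 is a nonresidue modulo 5, also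
    \<open>leg5\<close>. So all four classes contribute equally to the sum of \<open>charA\<close>,
    whence the factor 4.\<close>
  have neg: "sum gsign (C 1) = sum gsign (C 4)"
    by (rule sum.reindex_bij_witness[of _ "\<lambda>(x, y). (- x, - y)" "\<lambda>(x, y). (- x, - y)"])
      (auto simp: C_def lattice_points_def c)
  have rot: "sum gsign (C s) = - sum gsign (C r)" if "(s, r) \<in> {(3, 4), (2, 1)}" for s r
    unfolding sum_negf[symmetric]
    by (rule sum.reindex_bij_witness[of _ "\<lambda>(x, y). (- y, x)" "\<lambda>(x, y). (y, - x)"])
      (use that in \<open>auto simp: C_def lattice_points_def c\<close>)
  have "sum charA (lattice_points n) = (\<Sum>z\<in>lattice_points n.
      (if z \<in> C 1 then gsign z else 0) - (if z \<in> C 2 then gsign z else 0)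
      - (if z \<in> C 3 then gsign z else 0) + (if z \<in> C 4 then gsign z else 0))"
  proof (rule sum.cong[OF refl])
    fix z assume "z \<in> lattice_points n"
    moreover obtain x y where "z = (x, y)" by (cases z)
    moreover have "(x + 2 * y) mod 5 \<in> {0, 1, 2, 3, 4}"
      unfolding insert_iff empty_iff by presburger
    ultimately show "charA z = (if z \<in> C 1 then gsign z else 0) - (if z \<in> C 2 then gsign z else 0)
      - (if z \<in> C 3 then gsign z else 0) + (if z \<in> C 4 then gsign z else 0)"
      by (auto simp: C_def leg5_def)
  qed
  also have "\<dots> = sum gsign (C 1) - sum gsign (C 2) - sum gsign (C 3) + sum gsign (C 4)"
  proof -
    have "(\<Sum>z\<in>lattice_points n. if z \<in> C r then gsign z else 0) = sum gsign (C r)" for r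
      using finite_lattice_points by (intro sum.mono_neutral_cong_right) (auto simp: C_def)
    then show ?thesis by (simp only: sum.distrib sum_subtractf)
  qed
  finally show ?thesis
    using neg rot[of 3 4] rot[of 2 1] C4 by simp
qed

text \<open>The reflections k -> 1 - k and l -> 1 - l preserve the index set and flip the sign.
  Averaging over them replaces k l by (2 k - 1) (2 l - 1) / 4, and in the coordinates of the norm-n
  point this product is x^2 - y^2, the real part of z^2.\<close>

lemma coeff_B_lattice:
  "4 * of_int (fps_nth (fps_X * euler_f 4 ^ 6) n) = Re (sum charB (lattice_points n))"
proof -
  define T where "T = {(k, l). 2 * k * (k - 1) + 2 * l * (l - 1) + 1 = int n}"
  define e :: "int \<Rightarrow> int" where "e m = (if even m then 1 else - 1)" for m
  have "(\<Sum>(k, l)\<in>T. e (k + l) * (k * l)) = (\<Sum>(k, l)\<in>T. e (k + l) * ((k - 1) * l))"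
    by (rule sum.reindex_bij_witness[of _ "\<lambda>(k, l). (1 - k, l)" "\<lambda>(k, l). (1 - k, l)"])
      (auto simp: T_def e_def algebra_simps)
  moreover have "(\<Sum>(k, l)\<in>T. e (k + l) * (k * l)) + (\<Sum>(k, l)\<in>T. e (k + l) * ((k - 1) * l))
      = (\<Sum>(k, l)\<in>T. e (k + l) * ((2 * k - 1) * l))"
    unfolding sum.distrib[symmetric] by (intro sum.cong) (auto simp: algebra_simps)
  ultimately have 1: "2 * (\<Sum>(k, l)\<in>T. e (k + l) * (k * l)) = (\<Sum>(k, l)\<in>T. e (k + l) * ((2 * k - 1) * l))"
    by simp
  have "(\<Sum>(k, l)\<in>T. e (k + l) * ((2 * k - 1) * l)) = (\<Sum>(k, l)\<in>T. e (k + l) * ((2 * k - 1) * (l - 1)))"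
    by (rule sum.reindex_bij_witness[of _ "\<lambda>(k, l). (k, 1 - l)" "\<lambda>(k, l). (k, 1 - l)"])
      (auto simp: T_def e_def algebra_simps)
  moreover have "(\<Sum>(k, l)\<in>T. e (k + l) * ((2 * k - 1) * l)) + (\<Sum>(k, l)\<in>T. e (k + l) * ((2 * k - 1) * (l - 1)))
      = (\<Sum>(k, l)\<in>T. e (k + l) * ((2 * k - 1) * (2 * l - 1)))"
    unfolding sum.distrib[symmetric] by (intro sum.cong) (auto simp: algebra_simps)
  ultimately have "4 * (\<Sum>(k, l)\<in>T. e (k + l) * (k * l)) = (\<Sum>(k, l)\<in>T. e (k + l) * ((2 * k - 1) * (2 * l - 1)))"
    using 1 by simp
  \<comment> \<open>\<open>2 k - 1 + (2 l - 1) i = (1 + i) (x + i y)\<close>\<close>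
  also have "\<dots> = (\<Sum>z\<in>{z \<in> lattice_points n. odd (fst z + snd z)}. gsign z * (fst z ^ 2 - snd z ^ 2))"
  proof (rule sum.reindex_bij_witness[of _ "\<lambda>(x, y). ((x - y + 1) div 2, (x + y + 1) div 2)" "\<lambda>(k, l). (k + l - 1, l - k)"], goal_cases)
    case (3 z)
    obtain x y where z: "z = (x, y)" by (cases z)
    then have "odd (x + y)" using 3 by simp
    then obtain l where "x + y = 2 * l + 1" by (elim oddE)
    then have "x - y + 1 = (l + 1 - y) * 2" "x + y + 1 = (l + 1) * 2" and x: "x = 2 * l + 1 - y"
      by simp_all
    then have d: "(x - y + 1) div 2 = l + 1 - y" "(x + y + 1) div 2 = l + 1"
      by simp_all
    show ?case by (simp only: z case_prod_conv d) (simp add: x)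
  next
    case (4 z)
    obtain x y where z: "z = (x, y)" by (cases z)
    then have xy: "odd (x + y)" "x * x + y * y = int n"
      using 4 by (simp_all add: lattice_points_def)
    then obtain l where "x + y = 2 * l + 1" by (elim oddE)
    then have "x - y + 1 = (l + 1 - y) * 2" "x + y + 1 = (l + 1) * 2" and x: "x = 2 * l + 1 - y"
      by simp_all
    then have d: "(x - y + 1) div 2 = l + 1 - y" "(x + y + 1) div 2 = l + 1"
      by simp_all
    show ?case using xy(2) by (simp only: z case_prod_conv d) (simp add: x T_def algebra_simps)
  qed (auto simp: T_def e_def lattice_points_def algebra_simps power2_eq_square)
  also have "\<dots> = (\<Sum>z\<in>lattice_points n. gsign z * (fst z ^ 2 - snd z ^ 2))"
    using finite_lattice_points by (intro sum.mono_neutral_left) (auto split: if_splits)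
  finally have "4 * fps_nth (fps_X * euler_f 4 ^ 6) n = (\<Sum>z\<in>lattice_points n. gsign z * (fst z ^ 2 - snd z ^ 2))"
    unfolding fps_nth_euler_f_4_power_6 T_def e_def .
  from arg_cong[OF this, of real_of_int]
  have "4 * of_int (fps_nth (fps_X * euler_f 4 ^ 6) n)
      = (\<Sum>z\<in>lattice_points n. real_of_int (gsign z * (fst z ^ 2 - snd z ^ 2)))"
    by (simp only: of_int_sum of_int_numeral of_int_mult)
  also have "\<dots> = Re (sum charB (lattice_points n))"
    unfolding Re_sum by (intro sum.cong) (auto simp: power2_eq_square)
  finally show ?thesis .
qed

lemma gsign_gmult: "gsign (gmult z w) = gsign z * gsign w"
  by (cases z; cases w) auto

lemma leg5_mult: "leg5 (a * b) = leg5 a * leg5 b"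
proof -
  have "(a * b) mod 5 = ((a mod 5) * (b mod 5)) mod 5"
    by (simp add: mod_mult_eq)
  then show ?thesis
    unfolding leg5_def using mod_5_cases[of a] mod_5_cases[of b] by (elim disjE) simp_all
qed

lemma leg5_cong: "a mod 5 = b mod 5 \<Longrightarrow> leg5 a = leg5 b"
  by (simp add: leg5_def)

text \<open>Since 2^2 = -1 modulo 5, the map sending x + i y to x + 2 y is a ring homomorphism
  modulo 5.\<close>

lemma charA_gmult: "charA (gmult z w) = charA z * charA w"
proof (cases z; cases w)
  fix a b c d assume zw: "z = (a, b)" "w = (c, d)"
  have "(a * c - b * d) + 2 * (a * d + b * c) = (a + 2 * b) * (c + 2 * d) + 5 * (- b * d)"
    by (simp add: algebra_simps)
  then have "leg5 ((a * c - b * d) + 2 * (a * d + b * c)) = leg5 ((a + 2 * b) * (c + 2 * d))"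
    by (intro leg5_cong) (metis mod_mult_self2)
  then show ?thesis
    using gsign_gmult[of z w] by (simp add: zw leg5_mult del: gsign.simps)
qed

lemma charB_gmult: "charB (gmult z w) = charB z * charB w"
proof (cases z; cases w)
  fix a b c d assume zw: "z = (a, b)" "w = (c, d)"
  have "Complex (of_int (a * c - b * d)) (of_int (a * d + b * c))
      = Complex (of_int a) (of_int b) * Complex (of_int c) (of_int d)"
    by (simp add: complex_eq_iff)
  then show ?thesis
    using gsign_gmult[of z w] by (simp add: zw power_mult_distrib del: gsign.simps)
qed

subsection \<open>Hecke recursions\<close>

lemma minus_one_quadratic_residue:
  fixes p :: nat
  assumes "prime p" "p mod 4 = 1"
  shows "\<exists>r::int. int p dvd r * r + 1"
proof -
  have "p \<noteq> 2" using assms(2) by auto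
  then have "2 < p" using prime_ge_2_nat[OF assms(1)] by simp
  obtain m where m: "p = 4 * m + 1" using assms(2) by (metis mult_div_mod_eq)
  have "[Legendre (- 1) (int p) = (- 1) ^ ((p - 1) div 2)] (mod int p)"
    using assms(1) \<open>2 < p\<close> by (rule euler_criterion)
  then have "[Legendre (- 1) (int p) = 1] (mod int p)"
    by (simp add: m)
  moreover have "\<not> [- 1 = 1] (mod int p)"
    using \<open>2 < p\<close> by (auto simp: cong_iff_dvd_diff dest!: zdvd_imp_le)
  moreover have "\<not> [0 = 1] (mod int p)"
    using \<open>2 < p\<close> by (auto simp: cong_iff_dvd_diff)
  ultimately have "QuadRes (int p) (- 1)"
    by (auto simp: Legendre_def split: if_splits)
  then obtain r where "[r ^ 2 = - 1] (mod int p)"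
    unfolding QuadRes_def by blast
  then show ?thesis
    by (auto simp: cong_iff_dvd_diff power2_eq_square)
qed

text \<open>Thue's argument: there are more than p pairs (u, v) with entries up to the integer part
  of the root of p, so two of them share u - r v modulo p. Their difference (a, b) has a^2 + b^2
  divisible by p and strictly between 0 and 2 p.\<close>

lemma prime_sum_of_two_squares:
  fixes p :: nat
  assumes "prime p" "p mod 4 = 1"
  obtains a b :: int where "a * a + b * b = int p"
proof -
  obtain r :: int where r: "int p dvd r * r + 1"
    using minus_one_quadratic_residue[OF assms] ..
  have p1: "p > 1" using assms(1) by (rule prime_gt_1_nat)
  define s where "s = nat \<lfloor>sqrt (real p)\<rfloor>"
  have s0: "real s = of_int \<lfloor>sqrt (real p)\<rfloor>"
    by (simp add: s_def)
  have "real s \<le> sqrt p"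
    unfolding s0 by linarith
  then have "real s ^ 2 \<le> sqrt p ^ 2"
    by (intro power_mono) auto
  then have "real (s * s) \<le> real p"
    by (simp add: power2_eq_square)
  then have "s * s \<le> p" by linarith
  moreover have "s * s \<noteq> p"
  proof
    assume "s * s = p"
    then have "prime (s * s)" using assms(1) by simp
    then have "s = 1" using prime_product by blast
    then show False using \<open>s * s = p\<close> p1 by simp
  qed
  ultimately have s: "s * s < p" by simp
  have "sqrt p < real s + 1"
    unfolding s0 by linarith
  then have "sqrt p ^ 2 < (real s + 1) ^ 2"
    by (intro power_strict_mono) auto
  then have "real p < real ((s + 1) * (s + 1))"
    by (simp add: power2_eq_square algebra_simps)
  then have s': "p < (s + 1) * (s + 1)" by linarith
  define I where "I = {0..int s} \<times> {0..int s}"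
  define h where "h = (\<lambda>(u, v). (u - r * v) mod int p)"
  have "h ` I \<subseteq> {0..<int p}"
    using p1 by (auto simp: h_def)
  then have "card (h ` I) \<le> p"
    by (metis card_atLeastLessThan_int card_mono diff_zero finite_atLeastLessThan_int nat_int)
  also have "\<dots> < card I"
    using s' by (simp add: I_def card_cartesian_product nat_add_distrib)
  finally have "\<not> inj_on h I"
    by (rule pigeonhole)
  then obtain u v u' v' where uv: "(u, v) \<in> I" "(u', v') \<in> I" "h (u, v) = h (u', v')" "(u, v) \<noteq> (u', v')"
    unfolding inj_on_def by fast
  define a where "a = u - u'"
  define b where "b = v - v'"
  have "int p dvd (u - r * v) - (u' - r * v')"
    using uv(3) by (simp add: h_def mod_eq_dvd_iff)
  then have "int p dvd a - r * b"
    by (simp add: a_def b_def algebra_simps)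
  then have "int p dvd (a - r * b) * (a + r * b) + (r * r + 1) * (b * b)"
    using r by simp
  then have dvd: "int p dvd a * a + b * b"
    by (simp add: algebra_simps)
  have "\<bar>a\<bar> \<le> int s" "\<bar>b\<bar> \<le> int s"
    using uv(1,2) by (auto simp: I_def a_def b_def)
  then have "\<bar>a\<bar> * \<bar>a\<bar> \<le> int s * int s" "\<bar>b\<bar> * \<bar>b\<bar> \<le> int s * int s"
    by (intro mult_mono; simp)+
  moreover have "int s * int s < int p"
    using s by (simp flip: of_nat_mult)
  ultimately have less: "a * a + b * b < 2 * int p" by simp
  have "a \<noteq> 0 \<or> b \<noteq> 0"
    using uv(4) by (auto simp: a_def b_def)
  then have pos: "0 < a * a + b * b"
    by (metis less_eq_int_code(1) linorder_not_less not_sum_squares_lt_zero order_le_less sum_squares_eq_zero_iff)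
  obtain m where m: "a * a + b * b = int p * m" using dvd ..
  have "0 < m" using pos p1 by (auto simp: m zero_less_mult_iff)
  moreover have "m < 2" using less p1 by (simp add: m)
  ultimately have "m = 1" by simp
  then have "a * a + b * b = int p" by (simp add: m)
  then show thesis by (rule that)
qed

text \<open>Otherwise y is prime to p too. Raising x^2 = - y^2 modulo p to the power (p - 1) / 2,
  which is odd, gives 1 = -1 by Fermat's theorem.\<close>

lemma prime_3_mod_4_dvd_sum_of_squares:
  fixes p :: nat and x y :: int
  assumes "prime p" "p mod 4 = 3" "int p dvd x * x + y * y"
  shows "int p dvd x"
proof (rule ccontr)
  assume x: "\<not> int p dvd x"
  obtain m where m: "p = 4 * m + 3" using assms(2) by (metis mult_div_mod_eq)
  have p: "prime (int p)" using assms(1) by simp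
  have "\<not> int p dvd y"
  proof
    assume "int p dvd y"
    then have "int p dvd y * y" by simp
    then have "int p dvd x * x" using assms(3) by (metis dvd_add_left_iff)
    then show False using x p by (simp add: prime_dvd_mult_iff)
  qed
  have fermat: "[z ^ (p - 1) = 1] (mod int p)" if "\<not> int p dvd z" for z :: int
  proof -
    define w where "w = nat (z mod int p)"
    have "p > 0" using assms(1) by (rule prime_gt_0_nat)
    then have w: "[int w = z] (mod int p)"
      by (simp add: w_def cong_def)
    then have "\<not> p dvd w"
      using that by (metis cong_dvd_iff dvd_refl int_dvd_int_iff cong_0_iff cong_sym cong_trans)
    then have "[w ^ (p - 1) = 1] (mod p)"
      using assms(1) by (rule fermat_theorem[rotated])
    then have "[int w ^ (p - 1) = 1] (mod int p)"
      by (metis cong_int_iff of_nat_1 of_nat_power)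
    moreover have "[int w ^ (p - 1) = z ^ (p - 1)] (mod int p)"
      using w by (rule cong_pow)
    ultimately show ?thesis by (meson cong_sym cong_trans)
  qed
  have pw: "z ^ (p - 1) = (z * z) ^ (2 * m + 1)" for z :: int
    by (simp add: m power_mult_distrib power_add[symmetric] mult_2[symmetric] power_mult flip: power2_eq_square)
  have "[x * x = - (y * y)] (mod int p)"
    using assms(3) by (simp add: cong_iff_dvd_diff)
  then have "[(x * x) ^ (2 * m + 1) = (- (y * y)) ^ (2 * m + 1)] (mod int p)"
    by (rule cong_pow)
  also have "(- (y * y)) ^ (2 * m + 1) = - ((y * y) ^ (2 * m + 1))"
    by (rule power_minus_odd) simp
  finally have "[x ^ (p - 1) = - (y ^ (p - 1))] (mod int p)"
    by (simp only: pw)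
  moreover have "[- (y ^ (p - 1)) = - 1] (mod int p)"
    using fermat[OF \<open>\<not> int p dvd y\<close>] by (simp only: cong_minus_minus_iff)
  ultimately have "[1 = - 1] (mod int p)"
    using fermat[OF x] by (meson cong_sym cong_trans)
  then have "int p dvd 2" by (simp add: cong_iff_dvd_diff)
  then have "int p \<le> 2" by (rule zdvd_imp_le) simp
  then show False by (simp add: m)
qed

section \<open>Lattice points of norm p n\<close>

lemma gmult_scalar: "gmult (c, 0) (x, y) = (c * x, c * y)"
  by simp

lemma gmult_conj: "gmult (a, - b) (gmult (a, b) (x, y)) = ((a * a + b * b) * x, (a * a + b * b) * y)"
  by (simp add: algebra_simps)

lemma gmult_lattice_points:
  assumes "(x, y) \<in> lattice_points n" "a * a + b * b = int m"
  shows "gmult (a, b) (x, y) \<in> lattice_points (m * n)"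
proof -
  have "(a * x - b * y) * (a * x - b * y) + (a * y + b * x) * (a * y + b * x) = (a * a + b * b) * (x * x + y * y)"
    by (simp add: algebra_simps)
  then show ?thesis using assms by (simp add: lattice_points_def)
qed

lemma inj_gmult:
  assumes "a * a + b * b = int m" "m > 0"
  shows "inj (gmult (a, b))"
proof (rule injI)
  fix z w assume "gmult (a, b) z = gmult (a, b) w"
  then have "gmult (a, - b) (gmult (a, b) z) = gmult (a, - b) (gmult (a, b) w)" by simp
  then show "z = w"
    using assms by (cases z; cases w) (simp only: gmult_conj, simp)
qed

lemma lattice_points_scale:
  assumes "m > 0"
  shows "(int m * x, int m * y) \<in> lattice_points (m * m * n) \<longleftrightarrow> (x, y) \<in> lattice_points n"
proof -
  have "(int m * x) * (int m * x) + (int m * y) * (int m * y) = (int m * int m) * (x * x + y * y)"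
    by (simp add: algebra_simps)
  then show ?thesis using assms by (simp add: lattice_points_def)
qed

text \<open>A criterion for a + i b to divide z: p must divide both coordinates of (a - i b) z. The
  first is assumed divisible, and the second follows because the norm of this product is divisible
  by p.\<close>

lemma gmult_cover:
  assumes p: "prime p" "a * a + b * b = int p" and z: "(x, y) \<in> lattice_points (p * n)"
    and d: "int p dvd a * x + b * y"
  shows "(x, y) \<in> gmult (a, b) ` lattice_points n"
proof -
  have p': "prime (int p)" "int p > 0" using p(1) prime_gt_0_nat by auto
  have g: "gmult (a, - b) (x, y) = (a * x + b * y, a * y - b * x)" by simp
  have l: "(a * x + b * y, a * y - b * x) \<in> lattice_points (p * (p * n))"
    using gmult_lattice_points[OF z, of a "- b" p] p(2) by simp
  then have "(a * y - b * x) * (a * y - b * x) = int p * int (p * n) - (a * x + b * y) * (a * x + b * y)"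
    by (simp add: lattice_points_def algebra_simps)
  then have "int p dvd (a * y - b * x) * (a * y - b * x)"
    using d by simp
  then have "int p dvd a * y - b * x"
    using p'(1) by (simp add: prime_dvd_mult_iff)
  then obtain u v where uv: "a * x + b * y = int p * u" "a * y - b * x = int p * v"
    using d by (elim dvdE) blast
  have "(u, v) \<in> lattice_points n"
    using l p'(2) unfolding uv by (subst (asm) mult.assoc[symmetric]) (simp add: lattice_points_scale)
  moreover have "gmult (a, b) (u, v) = (x, y)"
  proof -
    have "gmult (a, b) (int p * u, int p * v) = (int p * x, int p * y)"
      using gmult_conj[of a "- b" x y] g p(2) by (simp add: uv)
    then have "int p * (a * u - b * v) = int p * x" "int p * (a * v + b * u) = int p * y"
      by (simp_all add: algebra_simps)
    then show ?thesis using p'(2) by simp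
  qed
  ultimately show ?thesis by (metis imageI)
qed

text \<open>Inclusion-exclusion: every point of norm p n is a multiple of a + i b or of a - i b, and
  the common multiples are the multiples of p. They are p times the points of norm n / p.\<close>

lemma sum_lattice_points_split:
  fixes f :: "int \<times> int \<Rightarrow> 'a::comm_ring_1"
  assumes mult: "\<And>z w. f (gmult z w) = f z * f w"
    and p: "prime p" "odd p" "a * a + b * b = int p"
  shows "sum f (lattice_points (p * n)) = (f (a, b) + f (a, - b)) * sum f (lattice_points n)
    - (if p dvd n then f (int p, 0) * sum f (lattice_points (n div p)) else 0)"
proof -
  let ?L = "lattice_points n"
  have p0: "p > 0" and p': "prime (int p)" using p(1) prime_gt_0_nat by auto
  have p3: "a * a + (- b) * (- b) = int p" using p(3) by simp
  have un: "lattice_points (p * n) = gmult (a, b) ` ?L \<union> gmult (a, - b) ` ?L"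
  proof (intro equalityI subsetI)
    fix z assume z: "z \<in> lattice_points (p * n)"
    obtain x y where xy: "z = (x, y)" by (cases z)
    \<comment> \<open>Each factor on the left decides, through \<open>gmult_cover\<close>,
      divisibility by one of the two conjugates.\<close>
    have "(a * x + b * y) * (a * x + (- b) * y) = a * a * (x * x + y * y) - (a * a + b * b) * (y * y)"
      by (simp add: algebra_simps)
    also have "int p dvd \<dots>"
      using z p(3) by (simp add: xy lattice_points_def)
    finally have "int p dvd a * x + b * y \<or> int p dvd a * x + (- b) * y"
      using p' by (simp only: prime_dvd_mult_iff)
    then show "z \<in> gmult (a, b) ` ?L \<union> gmult (a, - b) ` ?L"
      using gmult_cover[OF p(1) p(3)] gmult_cover[OF p(1) p3] z unfolding xy by blast
  next
    fix z assume "z \<in> gmult (a, b) ` ?L \<union> gmult (a, - b) ` ?L"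
    then show "z \<in> lattice_points (p * n)"
      using gmult_lattice_points[OF _ p(3)] gmult_lattice_points[OF _ p3] by auto
  qed
  have inter: "gmult (a, b) ` ?L \<inter> gmult (a, - b) ` ?L
    = (if p dvd n then gmult (int p, 0) ` lattice_points (n div p) else {})" (is "?I = ?J")
  proof (intro equalityI subsetI)
    fix z assume z: "z \<in> ?I"
    then have zl: "z \<in> lattice_points (p * n)" using un by blast
    obtain x y where xy: "z = (x, y)" by (cases z)
    obtain w where "w \<in> ?L" "(x, y) = gmult (a, b) w" using z unfolding xy by blast
    then obtain u v where "(x, y) = gmult (a, b) (u, v)" by (cases w) blast
    then have 1: "gmult (a, - b) (x, y) = (int p * u, int p * v)"
      using gmult_conj[of a b u v] p(3) by simp
    obtain w' where "w' \<in> ?L" "(x, y) = gmult (a, - b) w'" using z unfolding xy by blast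
    then obtain s t where "(x, y) = gmult (a, - b) (s, t)" by (cases w') blast
    then have 2: "gmult (a, b) (x, y) = (int p * s, int p * t)"
      using gmult_conj[of a "- b" s t] p(3) by simp
    \<comment> \<open>Adding (a - i b) z and (a + i b) z gives 2 a z. Since p divides neither 2 nor
      a, it divides both coordinates of z.\<close>
    have "2 * a * x = int p * (u + s)" "2 * a * y = int p * (v + t)"
      using 1 2 by (simp_all add: algebra_simps)
    then have "int p dvd 2 * a * x" "int p dvd 2 * a * y" by simp_all
    moreover have "\<not> int p dvd 2"
      using p(1,2) by (metis dvd_refl even_of_nat of_nat_numeral p' prime_int_numeral_eq primes_dvd_imp_eq two_is_prime_nat)
    moreover have "\<not> int p dvd a"
    proof
      assume "int p dvd a"
      then obtain k where k: "a = int p * k" ..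
      have "b * b = int p - a * a" using p(3) by simp
      then have "int p dvd b * b" by (simp add: k)
      then have "int p dvd b" using p' by (simp add: prime_dvd_mult_iff)
      then obtain m where m: "b = int p * m" ..
      have "int p * (int p * (k * k + m * m)) = int p * 1"
        using p(3) by (simp add: k m algebra_simps)
      then have "int p * (k * k + m * m) = 1" using p0 by (simp only: mult_cancel_left) simp
      then have "int p dvd 1" by (metis dvd_triv_left)
      then show False using p' by auto
    qed
    ultimately have "int p dvd x" "int p dvd y"
      using p' by (simp_all add: prime_dvd_mult_iff)
    then obtain s t where st: "x = int p * s" "y = int p * t" by (elim dvdE)
    have "int p * (int p * (s * s + t * t)) = int p * int n"
      using zl by (simp add: xy st lattice_points_def algebra_simps)
    then have n: "int p * (s * s + t * t) = int n" using p0 by simp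
    then have "p dvd n" by (metis dvd_triv_left int_dvd_int_iff)
    then have "int (n div p) = s * s + t * t"
      using n p0 by (simp add: zdiv_int flip: n)
    then have "(s, t) \<in> lattice_points (n div p)" by (simp add: lattice_points_def)
    then have "gmult (int p, 0) (s, t) \<in> gmult (int p, 0) ` lattice_points (n div p)" by (rule imageI)
    then show "z \<in> ?J" using \<open>p dvd n\<close> by (simp add: xy st)
  next
    fix z assume z: "z \<in> ?J"
    then have "p dvd n" by (auto split: if_splits)
    then obtain w where w: "w \<in> lattice_points (n div p)" "z = gmult (int p, 0) w"
      using z by auto
    obtain s t where st: "w = (s, t)" by (cases w)
    have n: "p * (n div p) = n" using \<open>p dvd n\<close> by simp
    have "z = gmult (a, b) (gmult (a, - b) w)" "z = gmult (a, - b) (gmult (a, b) w)"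
      using gmult_conj[of a b s t] gmult_conj[of a "- b" s t] p(3) by (simp_all only: w(2) st gmult_scalar) simp_all
    moreover have "gmult (a, b) w \<in> ?L" "gmult (a, - b) w \<in> ?L"
      using gmult_lattice_points[of s t "n div p" a b p] gmult_lattice_points[of s t "n div p" a "- b" p]
        w(1) p(3) p3 unfolding st n by blast+
    ultimately show "z \<in> ?I" by blast
  qed
  have reindex: "sum f (gmult c ` M) = f c * sum f M" if "inj (gmult c)" for c M
    using inj_on_subset[OF that, of M] by (simp add: sum.reindex mult sum_distrib_left)
  have "sum f (lattice_points (p * n)) + sum f ?I = sum f (gmult (a, b) ` ?L) + sum f (gmult (a, - b) ` ?L)"
    unfolding un by (rule sum.union_inter) (simp_all add: finite_lattice_points)
  moreover have "sum f ?I = (if p dvd n then f (int p, 0) * sum f (lattice_points (n div p)) else 0)"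
    unfolding inter using reindex[OF inj_gmult[of "int p" 0 "p * p"]] p0 by simp
  moreover have "sum f (gmult (a, b) ` ?L) = f (a, b) * sum f ?L" "sum f (gmult (a, - b) ` ?L) = f (a, - b) * sum f ?L"
    using reindex[OF inj_gmult[OF p(3) p0]] reindex[OF inj_gmult[OF p3 p0]] by simp_all
  ultimately show ?thesis by (simp add: algebra_simps)
qed

text \<open>Such a prime divides both coordinates of every point of norm p n, so these points are p
  times those of norm n / p.\<close>

lemma sum_lattice_points_inert:
  fixes f :: "int \<times> int \<Rightarrow> 'a::comm_ring_1"
  assumes mult: "\<And>z w. f (gmult z w) = f z * f w"
    and p: "prime p" "p mod 4 = 3"
  shows "sum f (lattice_points (p * n)) = (if p dvd n then f (int p, 0) * sum f (lattice_points (n div p)) else 0)"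
proof -
  have p0: "p > 0" using p(1) prime_gt_0_nat by auto
  have "lattice_points (p * n) = (if p dvd n then gmult (int p, 0) ` lattice_points (n div p) else {})" (is "_ = ?J")
  proof (intro equalityI subsetI)
    fix z assume z: "z \<in> lattice_points (p * n)"
    obtain x y where xy: "z = (x, y)" by (cases z)
    have "int p dvd x * x + y * y" "int p dvd y * y + x * x"
      using z by (simp_all add: xy lattice_points_def add.commute)
    then have "int p dvd x" "int p dvd y"
      using prime_3_mod_4_dvd_sum_of_squares[OF p] by blast+
    then obtain s t where st: "x = int p * s" "y = int p * t" by (elim dvdE)
    have "int p * (int p * (s * s + t * t)) = int p * int n"
      using z by (simp add: xy st lattice_points_def algebra_simps)
    then have n: "int p * (s * s + t * t) = int n" using p0 by simp
    then have "p dvd n" by (metis dvd_triv_left int_dvd_int_iff)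
    then have "int (n div p) = s * s + t * t"
      using n p0 by (simp add: zdiv_int flip: n)
    then have "(s, t) \<in> lattice_points (n div p)" by (simp add: lattice_points_def)
    then have "gmult (int p, 0) (s, t) \<in> gmult (int p, 0) ` lattice_points (n div p)" by (rule imageI)
    then show "z \<in> ?J" using \<open>p dvd n\<close> by (simp add: xy st)
  next
    fix z assume z: "z \<in> ?J"
    then have "p dvd n" by (auto split: if_splits)
    then obtain w where w: "w \<in> lattice_points (n div p)" "z = gmult (int p, 0) w"
      using z by auto
    obtain s t where st: "w = (s, t)" by (cases w)
    have "gmult (int p, 0) (s, t) \<in> lattice_points (p * p * (n div p))"
      using w(1) p0 unfolding st gmult_scalar by (simp add: lattice_points_scale del: gmult.simps)
    then show "z \<in> lattice_points (p * n)"
      using \<open>p dvd n\<close> by (simp add: w(2) st mult.assoc)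
  qed
  moreover have "inj_on (gmult (int p, 0)) (lattice_points (n div p))"
    by (rule inj_on_subset[OF inj_gmult[of "int p" 0 "p * p"] subset_UNIV]) (use p0 in simp_all)
  ultimately show ?thesis
    by (simp add: sum.reindex mult sum_distrib_left)
qed

subsection \<open>Lucas sequences and the local comparison\<close>

text \<open>The complete homogeneous symmetric function of degree k in the two roots of X^2 - t X +
  d, that is, the value at p^k of a sequence with Hecke recursion of trace t and determinant
  d.\<close>

fun lucas :: "int \<Rightarrow> int \<Rightarrow> nat \<Rightarrow> int" where
  "lucas t d 0 = 1"
| "lucas t d (Suc 0) = t"
| "lucas t d (Suc (Suc k)) = t * lucas t d (Suc k) - d * lucas t d k"

lemma lucas_cong:
  assumes "[t = t'] (mod m)" "[d = d'] (mod m)"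
  shows "[lucas t d k = lucas t' d' k] (mod m)"
  using assms by (induction t d k rule: lucas.induct) (auto intro!: cong_diff cong_mult)

lemma lucas_double_root: "lucas (2 * c) (c * c) k = (int k + 1) * c ^ k"
proof (induction "2 * c" "c * c" k rule: lucas.induct)
  case (3 k)
  then show ?case by (simp add: algebra_simps)
qed simp_all

lemma lucas_degenerate:
  assumes "t \<in> {0, 1, - 1}" "d \<in> {0, 1, - 1}" "t = 0 \<or> d = 0"
  shows "lucas t d k \<in> {0, 1, - 1}"
  using assms by (induction t d k rule: lucas.induct) auto

text \<open>Along m, p m, p^2 m, ... the Hecke recursion is that of \<open>lucas\<close>; the first
  step has no correction term because p does not divide m.\<close>

lemma lucas_multiplicative:
  fixes F :: "nat \<Rightarrow> int"
  assumes rec: "\<And>n. F (p * n) = t * F n - (if p dvd n then d * F (n div p) else 0)"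
    and "\<not> p dvd m" "p > 0"
  shows "F (p ^ k * m) = lucas t d k * F m"
proof (induction k rule: induct_nat_012)
  case 1
  then show ?case using rec[of m] assms(2) by simp
next
  case (ge2 k)
  have e: "p ^ Suc (Suc k) * m = p * (p ^ Suc k * m)" "p ^ Suc k * m div p = p ^ k * m" "p dvd p ^ Suc k * m"
    using assms(3) by (simp_all add: mult.assoc)
  show ?case
    unfolding e(1) rec[of "p ^ Suc k * m"] e(2) ge2 using e(3) by (simp add: algebra_simps)
qed simp

section \<open>Comparison modulo 25 up to units\<close>

definition unit_multiple :: "int \<Rightarrow> int \<Rightarrow> bool" where
  "unit_multiple x y \<longleftrightarrow> (\<exists>w. \<not> 5 dvd w \<and> [y = w * x] (mod 25))"

lemma unit_multiple_mult:
  assumes "unit_multiple x y" "unit_multiple x' y'"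
  shows "unit_multiple (x * x') (y * y')"
proof -
  obtain w w' where w: "\<not> 5 dvd w" "[y = w * x] (mod 25)" "\<not> 5 dvd w'" "[y' = w' * x'] (mod 25)"
    using assms unfolding unit_multiple_def by blast
  have "\<not> 5 dvd w * w'"
    using w(1,3) by (simp add: prime_dvd_mult_iff)
  moreover have "[y * y' = (w * w') * (x * x')] (mod 25)"
    using cong_mult[OF w(2,4)] by (simp add: mult_ac)
  ultimately show ?thesis unfolding unit_multiple_def by blast
qed

lemma unit_multiple_dvd:
  assumes "unit_multiple x y" "25 dvd y"
  shows "25 dvd x"
proof -
  obtain w where w: "\<not> 5 dvd w" "[y = w * x] (mod 25)"
    using assms(1) unfolding unit_multiple_def by blast
  have "25 dvd w * x"
    using assms(2) w(2) by (metis cong_dvd_iff cong_sym dvd_refl cong_0_iff cong_trans)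
  moreover have "coprime (5 ^ 2) w"
    using w(1) by (intro coprime_power_left_iff[THEN iffD2] disjI1 prime_imp_coprime) auto
  ultimately show ?thesis
    by (simp add: coprime_dvd_mult_right_iff)
qed

text \<open>Two kinds of primes. In the first alternative the values of \<open>lucas t d\<close> lie
  in {0, 1, -1}, so agreement modulo 5 suffices. In the second, (t, d) has the double root e = 1 or
  -1, and (t', d') has modulo 25 a double root c prime to 5.\<close>

definition local_data :: "int \<Rightarrow> int \<Rightarrow> int \<Rightarrow> int \<Rightarrow> bool" where
  "local_data t d t' d' \<longleftrightarrow>
    (t \<in> {0, 1, - 1} \<and> d \<in> {0, 1, - 1} \<and> (t = 0 \<or> d = 0) \<and> [t' = t] (mod 5) \<and> [d' = d] (mod 5))
    \<or> (\<exists>e c. e * e = 1 \<and> t = 2 * e \<and> d = 1 \<and> t' = 2 * c \<and> \<not> 5 dvd c \<and> [d' = c * c] (mod 25))"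

lemma local_data_lucas:
  assumes "local_data t d t' d'"
  shows "lucas t d k = 0 \<or> unit_multiple (lucas t d k) (lucas t' d' k)"
proof -
  have degenerate: ?thesis if a: "t \<in> {0, 1, - 1}" "d \<in> {0, 1, - 1}" "t = 0 \<or> d = 0"
    and c: "[t' = t] (mod 5)" "[d' = d] (mod 5)"
  proof -
  define u where "u = lucas t d k"
  define v where "v = lucas t' d' k"
  have u: "u \<in> {0, 1, - 1}"
    unfolding u_def using a by (rule lucas_degenerate)
  have uv: "[v = u] (mod 5)"
    unfolding u_def v_def using c by (rule lucas_cong)
  have "unit_multiple u v" if "u \<noteq> 0"
  proof -
    have uu: "u * u = 1" using u that by auto
    have "\<not> 5 dvd v"
    proof
      assume "5 dvd v"
      then have "5 dvd u" using uv by (simp add: cong_dvd_iff)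
      then show False using u that by auto
    qed
    then have "\<not> 5 dvd v * u"
      using u that by auto
    \<comment> \<open>The required unit is v u, since u is its own inverse.\<close>
    moreover have "v = v * u * u"
      by (simp add: mult.assoc uu)
    ultimately show ?thesis
      unfolding unit_multiple_def by (metis cong_refl)
  qed
  then show ?thesis by (auto simp: u_def v_def)
  qed
  have double: ?thesis if ec: "e * e = 1" "t = 2 * e" "d = 1" "t' = 2 * c" "\<not> 5 dvd c" "[d' = c * c] (mod 25)" for e c
  proof -
  have 1: "lucas t d k = (int k + 1) * e ^ k"
    using lucas_double_root[of e k] ec by simp
  have "[lucas (2 * c) d' k = lucas (2 * c) (c * c) k] (mod 25)"
    using cong_refl ec(6) by (rule lucas_cong)
  then have 2: "[lucas t' d' k = (int k + 1) * c ^ k] (mod 25)"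
    by (simp only: lucas_double_root ec(4))
  have ee: "e ^ k * e ^ k = 1"
    using ec(1) by (simp flip: power_mult_distrib)
  have "\<not> 5 dvd (c * e) ^ k"
  proof
    assume "5 dvd (c * e) ^ k"
    then have "5 dvd c * e" by (rule prime_dvd_power[rotated]) simp
    then have "5 dvd c * e * e" by (rule dvd_mult2)
    then show False using ec(1,5) by (simp add: mult.assoc)
  qed
  \<comment> \<open>The factor k + 1, possibly divisible by 5, is common to both values, so they
    differ only by the unit (c e)^k.\<close>
  moreover have "(c * e) ^ k * ((int k + 1) * e ^ k) = (int k + 1) * c ^ k * (e ^ k * e ^ k)"
    by (simp add: power_mult_distrib algebra_simps)
  ultimately have "unit_multiple (lucas t d k) (lucas t' d' k)"
    unfolding unit_multiple_def using 2 1 ee by (metis mult.right_neutral)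
  then show ?thesis ..
  qed
  from assms[unfolded local_data_def] show ?thesis
  proof
    assume "t \<in> {0, 1, - 1} \<and> d \<in> {0, 1, - 1} \<and> (t = 0 \<or> d = 0) \<and> [t' = t] (mod 5) \<and> [d' = d] (mod 5)"
    then show ?thesis using degenerate by blast
  next
    assume "\<exists>e c. e * e = 1 \<and> t = 2 * e \<and> d = 1 \<and> t' = 2 * c \<and> \<not> 5 dvd c \<and> [d' = c * c] (mod 25)"
    then show ?thesis using double by blast
  qed
qed

text \<open>Strong induction that strips off the full power of one prime divisor. Multiplicativity
  of F and G is not assumed; the factorization comes from the recursion at that prime.\<close>

lemma unit_multiple_of_local_data:
  fixes F G :: "nat \<Rightarrow> int"
  assumes one: "F 1 = 1" "G 1 = 1"
    and loc: "\<And>p. prime p \<Longrightarrow> \<exists>t d t' d'. local_data t d t' d'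
      \<and> (\<forall>n. F (p * n) = t * F n - (if p dvd n then d * F (n div p) else 0))
      \<and> (\<forall>n. G (p * n) = t' * G n - (if p dvd n then d' * G (n div p) else 0))"
    and "n > 0"
  shows "F n = 0 \<or> unit_multiple (F n) (G n)"
  using \<open>n > 0\<close>
proof (induction n rule: less_induct)
  case (less n)
  show ?case
  proof (cases "n = 1")
    case True
    have "unit_multiple 1 1"
      unfolding unit_multiple_def by (rule exI[of _ 1]) simp
    then show ?thesis using True one by simp
  next
    case False
    then obtain p where p: "prime p" "p dvd n"
      using prime_factor_nat by blast
    obtain t d t' d' where l: "local_data t d t' d'"
      and F: "\<And>n. F (p * n) = t * F n - (if p dvd n then d * F (n div p) else 0)"
      and G: "\<And>n. G (p * n) = t' * G n - (if p dvd n then d' * G (n div p) else 0)"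
      using loc[OF p(1)] by blast
    have "n \<noteq> 0" "\<not> is_unit p"
      using less.prems p(1) by auto
    then obtain m where m: "n = p ^ multiplicity p n * m" "\<not> p dvd m"
      using multiplicity_decompose'[of n p] by metis
    define k where "k = multiplicity p n"
    have "k \<noteq> 0"
      using m p(2) unfolding k_def[symmetric] by (intro notI) simp
    then have "1 < p ^ k"
      using prime_gt_1_nat[OF p(1)] by (intro one_less_power) simp_all
    moreover have "m > 0" using m less.prems by (cases m) auto
    ultimately have "m < n"
      using m(1) unfolding k_def[symmetric] by simp
    then have IH: "F m = 0 \<or> unit_multiple (F m) (G m)"
      using less.IH \<open>m > 0\<close> by blast
    have "F n = lucas t d k * F m" "G n = lucas t' d' k * G m"
      using lucas_multiplicative[OF F m(2)] lucas_multiplicative[OF G m(2)] prime_gt_0_nat[OF p(1)] m(1)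
      unfolding k_def[symmetric] by simp_all
    then show ?thesis
      using IH local_data_lucas[OF l, of k] unit_multiple_mult by auto
  qed
qed

section \<open>Local parameters at split primes\<close>

lemma leg5_cong_square: "[leg5 z = z * z] (mod 5)"
proof -
  have "(z * z) mod 5 = ((z mod 5) * (z mod 5)) mod 5"
    by (simp add: mod_mult_eq)
  then show ?thesis
    unfolding leg5_def cong_def using mod_5_cases[of z] by (elim disjE) simp_all
qed

lemma leg5_range: "leg5 z \<in> {0, 1, - 1}"
  by (simp add: leg5_def)

lemma leg5_square: "leg5 z * leg5 z = (if 5 dvd z then 0 else 1)"
  by (auto simp: leg5_def)

text \<open>If 5 divides a b, both pairs have a double root, the second modulo 25. Otherwise a^2 +
  b^2 is 0, 2 or 3 modulo 5. Since (a + 2 b) (a - 2 b) is congruent to a^2 + b^2, the two symbols do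
  not have product 1, and the trace or the determinant for A vanishes.\<close>

lemma local_data_split:
  fixes a b s :: int
  assumes s: "s * s = 1" and ab: "\<not> (5 dvd a \<and> 5 dvd b)"
  shows "local_data (s * leg5 (a + 2 * b) + s * leg5 (a - 2 * b)) (leg5 (a * a + b * b))
    (2 * (s * (a * a - b * b))) ((a * a + b * b) * (a * a + b * b))"
proof (cases "5 dvd a \<or> 5 dvd b")
  case True
  \<comment> \<open>Modulo 5 one coordinate drops out, so a + 2 b and a - 2 b agree up to sign, and
    -1 is a square modulo 5.\<close>
  have "\<exists>z. \<not> 5 dvd z \<and> leg5 (a + 2 * b) = leg5 z \<and> leg5 (a - 2 * b) = leg5 z \<and> leg5 (a * a + b * b) = 1"
  proof (cases "5 dvd b")
    case True
    then obtain m where m: "b = 5 * m" ..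
    have "(a + 2 * b) mod 5 = a mod 5" "(a - 2 * b) mod 5 = a mod 5" "(a * a + b * b) mod 5 = (a * a) mod 5"
      using mod_mult_self2[of a 5 "2 * m"] mod_mult_self2[of a 5 "- 2 * m"] mod_mult_self2[of "a * a" 5 "5 * m * m"]
      by (simp_all add: m algebra_simps)
    then have "leg5 (a + 2 * b) = leg5 a" "leg5 (a - 2 * b) = leg5 a" "leg5 (a * a + b * b) = leg5 a * leg5 a"
      unfolding leg5_mult[symmetric] by (simp_all only: leg5_def)
    then show ?thesis using ab True by (auto simp: leg5_square)
  next
    case False
    then have "5 dvd a" using True by simp
    then obtain m where m: "a = 5 * m" ..
    have "(a + 2 * b) mod 5 = (2 * b) mod 5" "(a - 2 * b) mod 5 = (- 1 * (2 * b)) mod 5" "(a * a + b * b) mod 5 = (b * b) mod 5"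
      using mod_mult_self2[of "2 * b" 5 m] mod_mult_self2[of "- (2 * b)" 5 m] mod_mult_self2[of "b * b" 5 "5 * m * m"]
      by (simp_all add: m algebra_simps)
    then have "leg5 (a + 2 * b) = leg5 (2 * b)" "leg5 (a - 2 * b) = leg5 (- 1) * leg5 (2 * b)" "leg5 (a * a + b * b) = leg5 b * leg5 b"
      unfolding leg5_mult[symmetric] by (simp_all only: leg5_def)
    moreover have "leg5 (- 1) = 1" by (simp add: leg5_def)
    moreover have "\<not> 5 dvd 2 * b" using False by presburger
    ultimately show ?thesis using False by (auto simp: leg5_square)
  qed
  then obtain z where z: "\<not> 5 dvd z" "leg5 (a + 2 * b) = leg5 z" "leg5 (a - 2 * b) = leg5 z"
    "leg5 (a * a + b * b) = 1" by blast
  let ?c = "s * (a * a - b * b)"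
  have "(s * leg5 z) * (s * leg5 z) = (s * s) * (leg5 z * leg5 z)" by (simp add: algebra_simps)
  then have e: "(s * leg5 z) * (s * leg5 z) = 1" using s z(1) by (simp add: leg5_square)
  have "\<not> 5 dvd a * a - b * b"
  proof
    assume *: "5 dvd a * a - b * b"
    have p5: "prime (5::int)" by simp
    from True show False
    proof
      assume "5 dvd a"
      then have "5 dvd b * b" using * by (metis dvd_diff_right_iff dvd_mult)
      then show False using ab \<open>5 dvd a\<close> by (simp add: prime_dvd_mult_iff)
    next
      assume "5 dvd b"
      then have "5 dvd a * a" using * by (metis dvd_diff_left_iff dvd_mult)
      then show False using ab \<open>5 dvd b\<close> by (simp add: prime_dvd_mult_iff)
    qed
  qed
  moreover have "\<not> 5 dvd s" using s by (metis dvd_mult2 zdvd1_eq abs_numeral num.distinct(3) numeral_eq_one_iff)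
  ultimately have c: "\<not> 5 dvd ?c" by (simp add: prime_dvd_mult_iff)
  have "5 * 5 dvd (a * b) * (a * b)"
    using True by (intro mult_dvd_mono) (auto intro: dvd_mult dvd_mult2)
  then have "25 dvd 4 * ((a * b) * (a * b))" by simp
  moreover have "(a * a + b * b) * (a * a + b * b) - ?c * ?c = 4 * ((a * b) * (a * b))
      + (1 - s * s) * ((a * a - b * b) * (a * a - b * b))"
    by (simp add: algebra_simps)
  ultimately have d: "[(a * a + b * b) * (a * a + b * b) = ?c * ?c] (mod 25)"
    using s by (simp add: cong_iff_dvd_diff)
  show ?thesis
    unfolding local_data_def z using e c d by (intro disjI2 exI[of _ "s * leg5 z"] exI[of _ ?c]) simp
next
  case False
  let ?u = "leg5 (a + 2 * b)" and ?v = "leg5 (a - 2 * b)" and ?p = "a * a + b * b"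
  have s': "s \<in> {1, - 1}" using s by (auto simp: zmult_eq_1_iff)
  have "(a + 2 * b) * (a - 2 * b) = ?p + 5 * - (b * b)" by (simp add: algebra_simps)
  then have uv: "?u * ?v = leg5 ?p"
    unfolding leg5_mult[symmetric] by (metis leg5_cong mod_mult_self2)
  have "?p mod 5 = ((a mod 5) * (a mod 5) + (b mod 5) * (b mod 5)) mod 5"
    unfolding cong_def[symmetric] by (intro cong_add cong_mult) simp_all
  moreover have "a mod 5 \<in> {1, 2, 3, 4}" "b mod 5 \<in> {1, 2, 3, 4}"
    using False mod_5_cases[of a] mod_5_cases[of b] by (simp_all add: dvd_eq_mod_eq_0)
  moreover have "(i * i + j * j) mod 5 \<in> {0, 2, 3}" if "i \<in> {1, 2, 3, 4}" "j \<in> {1, 2, 3, 4}" for i j :: int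
    using that by (elim insertE emptyE) simp_all
  ultimately have "?p mod 5 \<in> {0, 2, 3}" by (simp only:)
  then have "leg5 ?p \<noteq> 1"
    unfolding leg5_def by (elim insertE emptyE) simp_all
  then have ne: "?u * ?v \<noteq> 1"
    unfolding uv .
  \<comment> \<open>Product different from 1 excludes equal nonzero symbols, hence the traces 2 and
    -2.\<close>
  have "s * u + s * v \<in> {0, 1, - 1} \<and> (s * u + s * v = 0 \<or> u * v = 0)"
    if "u \<in> {0, 1, - 1}" "v \<in> {0, 1, - 1}" "u * v \<noteq> 1" for u v
    using s' that by (elim insertE emptyE) simp_all
  from this[OF leg5_range leg5_range ne]
  have 1: "s * ?u + s * ?v \<in> {0, 1, - 1}" "s * ?u + s * ?v = 0 \<or> leg5 ?p = 0"
    unfolding uv by (rule conjunct1, rule conjunct2)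
  \<comment> \<open>Replacing each symbol by its square argument turns the trace for A into s (2 a^2
    + 8 b^2), which modulo 5 is the trace 2 s (a^2 - b^2) for B.\<close>
  have "[s * ?u + s * ?v = s * ((a + 2 * b) * (a + 2 * b)) + s * ((a - 2 * b) * (a - 2 * b))] (mod 5)"
    by (intro cong_add cong_mult cong_refl leg5_cong_square)
  moreover have "[2 * (s * (a * a - b * b)) = s * ((a + 2 * b) * (a + 2 * b)) + s * ((a - 2 * b) * (a - 2 * b))] (mod 5)"
  proof -
    have "s * ((a + 2 * b) * (a + 2 * b)) + s * ((a - 2 * b) * (a - 2 * b)) - 2 * (s * (a * a - b * b)) = 5 * (2 * (s * (b * b)))"
      by (simp add: algebra_simps)
    then show ?thesis by (metis cong_iff_dvd_diff cong_sym dvd_triv_left)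
  qed
  ultimately have 2: "[2 * (s * (a * a - b * b)) = s * ?u + s * ?v] (mod 5)"
    by (meson cong_sym cong_trans)
  have 3: "[?p * ?p = leg5 ?p] (mod 5)"
    using leg5_cong_square by (rule cong_sym)
  show ?thesis
    unfolding local_data_def by (intro disjI1 conjI 1 2 3 leg5_range)
qed

section \<open>The two coefficient sequences and the conclusion\<close>

definition coeffA :: "nat \<Rightarrow> int" where
  "coeffA n = fps_nth (fps_X * euler_f 4 * euler_f 20) n"

definition coeffB :: "nat \<Rightarrow> int" where
  "coeffB n = fps_nth (fps_X * euler_f 4 ^ 6) n"

lemmas coeff_lattice = coeff_A_lattice[folded coeffA_def] coeff_B_lattice[folded coeffB_def]

lemma complex_Re_of_real_mult: "Re (of_real r * z) = r * Re z"
  by simp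

lemma coeff_recursion_split:
  fixes a b :: int
  assumes p: "prime p" "odd p" "a * a + b * b = int p"
  shows "coeffA (p * n) = (gsign (a, b) * leg5 (a + 2 * b) + gsign (a, b) * leg5 (a - 2 * b)) * coeffA n
      - (if p dvd n then leg5 (int p) * coeffA (n div p) else 0)"
    and "coeffB (p * n) = 2 * (gsign (a, b) * (a * a - b * b)) * coeffB n
      - (if p dvd n then int p * int p * coeffB (n div p) else 0)"
proof -
  have s: "gsign (a, - b) = gsign (a, b)" "gsign (int p, 0) = 1"
    using p(2) by auto
  let ?t = "gsign (a, b) * leg5 (a + 2 * b) + gsign (a, b) * leg5 (a - 2 * b)"
  have c: "charA (a, b) + charA (a, - b) = ?t" "charA (int p, 0) = leg5 (int p)"
    using s by (simp_all del: gsign.simps)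
  have "4 * coeffA (p * n) = ?t * (4 * coeffA n)
      - (if p dvd n then leg5 (int p) * (4 * coeffA (n div p)) else 0)"
    unfolding coeff_lattice by (simp only: sum_lattice_points_split[of charA, OF charA_gmult p] c)
  then have "4 * coeffA (p * n) = 4 * (?t * coeffA n - (if p dvd n then leg5 (int p) * coeffA (n div p) else 0))"
    by (cases "p dvd n") (simp_all add: algebra_simps del: gsign.simps)
  then show "coeffA (p * n) = ?t * coeffA n - (if p dvd n then leg5 (int p) * coeffA (n div p) else 0)"
    by (simp only: mult_cancel_left) simp
  let ?t = "2 * (gsign (a, b) * (a * a - b * b))"
  \<comment> \<open>The conjugate values add up to a real number, so the recursion passes to real
    parts.\<close>
  have c: "charB (a, b) + charB (a, - b) = of_real (of_int ?t)" "charB (int p, 0) = of_real (of_int (int p * int p))"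
    using s by (simp_all del: gsign.simps add: complex_eq_iff power2_eq_square algebra_simps)
  have "4 * of_int (coeffB (p * n)) = of_int ?t * (4 * of_int (coeffB n))
      - (if p dvd n then of_int (int p * int p) * (4 * of_int (coeffB (n div p))) else (0 :: real))"
    unfolding coeff_lattice by (simp only: sum_lattice_points_split[of charB, OF charB_gmult p] c)
      (simp only: minus_complex.simps if_distrib[of Re] complex_Re_of_real_mult zero_complex.simps)
  then have "real_of_int (4 * coeffB (p * n))
      = real_of_int (4 * (?t * coeffB n - (if p dvd n then int p * int p * coeffB (n div p) else 0)))"
    by (cases "p dvd n") (simp_all add: algebra_simps del: gsign.simps)
  then show "coeffB (p * n) = ?t * coeffB n - (if p dvd n then int p * int p * coeffB (n div p) else 0)"
    by (simp only: of_int_eq_iff mult_cancel_left) simp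
qed

lemma coeff_recursion_inert:
  assumes p: "prime p" "p mod 4 = 3"
  shows "coeffA (p * n) = (if p dvd n then leg5 (int p) * coeffA (n div p) else 0)"
    and "coeffB (p * n) = (if p dvd n then int p * int p * coeffB (n div p) else 0)"
proof -
  have "odd p" using p(2) by presburger
  then have s: "gsign (int p, 0) = 1" by auto
  then have "charA (int p, 0) = leg5 (int p)" "charB (int p, 0) = of_real (of_int (int p * int p))"
    by (simp_all del: gsign.simps add: complex_eq_iff power2_eq_square)
  note c = this
  have "4 * coeffA (p * n) = (if p dvd n then leg5 (int p) * (4 * coeffA (n div p)) else 0)"
    unfolding coeff_lattice using sum_lattice_points_inert[of charA, OF charA_gmult p] c by simp
  then show "coeffA (p * n) = (if p dvd n then leg5 (int p) * coeffA (n div p) else 0)"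
    by (auto split: if_splits)
  have "4 * of_int (coeffB (p * n)) = (if p dvd n then of_int (int p * int p) * (4 * of_int (coeffB (n div p))) else (0 :: real))"
    unfolding coeff_lattice using sum_lattice_points_inert[of charB, OF charB_gmult p] c by simp
  then have "real_of_int (4 * coeffB (p * n)) = real_of_int (4 * (if p dvd n then int p * int p * coeffB (n div p) else 0))"
    by (cases "p dvd n") (simp_all add: algebra_simps del: gsign.simps)
  then show "coeffB (p * n) = (if p dvd n then int p * int p * coeffB (n div p) else 0)"
    by (simp only: of_int_eq_iff mult_cancel_left) simp
qed

text \<open>The recursion at p = 2 with all parameters 0: a point of even norm has x + y even, where
  \<open>gsign\<close> vanishes.\<close>

lemma coeff_even: "coeffA (2 * n) = 0" "coeffB (2 * n) = 0"
proof -
  have "gsign z = 0" if "z \<in> lattice_points (2 * n)" for z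
  proof (cases z)
    case (Pair x y)
    then have "x * x + y * y = 2 * int n" using that by (simp add: lattice_points_def)
    then have "even (x * x + y * y)" by simp
    then have "even (x + y)" by simp
    then show ?thesis by (simp add: Pair)
  qed
  then have "charA z = 0" "charB z = 0" if "z \<in> lattice_points (2 * n)" for z
    using that by (cases z; simp del: gsign.simps)+
  then have "4 * coeffA (2 * n) = 0" "4 * real_of_int (coeffB (2 * n)) = 0"
    unfolding coeff_lattice by simp_all
  then show "coeffA (2 * n) = 0" "coeffB (2 * n) = 0" by simp_all
qed

lemma coeff_local_data:
  assumes "prime p"
  shows "\<exists>t d t' d'. local_data t d t' d'
      \<and> (\<forall>n. coeffA (p * n) = t * coeffA n - (if p dvd n then d * coeffA (n div p) else 0))
      \<and> (\<forall>n. coeffB (p * n) = t' * coeffB n - (if p dvd n then d' * coeffB (n div p) else 0))"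
proof -
  have "odd p" if "p \<noteq> 2" using assms that primes_dvd_imp_eq two_is_prime_nat by blast
  moreover have "p mod 4 = 1 \<or> p mod 4 = 3" if "odd p" using that by presburger
  ultimately consider "p = 2" | "odd p" "p mod 4 = 1" | "p mod 4 = 3" by blast
  then show ?thesis
  proof cases
    case 1
    have "local_data 0 0 0 0" by (simp add: local_data_def)
    then show ?thesis unfolding 1 coeff_even by (intro exI[of _ 0]) simp
  next
    case 2
    obtain a b :: int where ab: "a * a + b * b = int p"
      using prime_sum_of_two_squares[OF assms 2(2)] .
    have "odd (a + b)"
    proof
      assume "even (a + b)"
      then have "even (a * a + b * b)" by simp
      then show False using 2(1) by (simp add: ab)
    qed
    then have s: "gsign (a, b) * gsign (a, b) = 1" by simp
    have "\<not> (5 dvd a \<and> 5 dvd b)"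
    proof
      assume "5 dvd a \<and> 5 dvd b"
      then have "5 * 5 dvd a * a" "5 * 5 dvd b * b" by (simp_all only: mult_dvd_mono)
      then have "5 * 5 dvd int p" unfolding ab[symmetric] by (rule dvd_add)
      then have "5 * 5 dvd p" by presburger
      moreover from this have "5 dvd p" by (rule dvd_mult_left)
      then have "p = 5" using assms using primes_dvd_imp_eq[of 5 p] by simp
      ultimately show False by simp
    qed
    from local_data_split[OF s this] show ?thesis
      unfolding ab using coeff_recursion_split[OF assms 2(1) ab] by blast
  next
    case 3
    \<comment> \<open>The inert recursion adds its second term whereas a Hecke recursion subtracts
      it, so the determinants carry a minus sign.\<close>
    have "local_data 0 (- leg5 (int p)) 0 (- (int p * int p))"
      unfolding local_data_def using leg5_range[of "int p"] leg5_cong_square[of "int p"]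
      by (intro disjI1) (auto simp: cong_minus_minus_iff intro: cong_sym)
    then show ?thesis
      unfolding coeff_recursion_inert[OF assms 3]
      by (intro exI[of _ 0] exI[of _ "- leg5 (int p)"] exI[of _ "- (int p * int p)"]) simp
  qed
qed

lemma euler_f_nth_0: "j > 0 \<Longrightarrow> fps_nth (euler_f j) 0 = 1"
  using euler_f_truncation[of j 0] by (auto simp: fps_X_power_dvd_iff)

lemma coeff_1: "coeffA 1 = 1" "coeffB 1 = 1"
  by (simp_all add: coeffA_def coeffB_def mult.assoc euler_f_nth_0 fps_power_zeroth)

text \<open>From 13 = 3^2 + 2^2: \<open>leg5\<close> has opposite values at 3 + 4 and 3 - 4, while 2
  (3^2 - 2^2) = 10. This index makes the inclusion strict.\<close>

lemma coeffA_13: "coeffA 13 = 0" and coeffB_13: "coeffB 13 = 10"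
proof -
  have "prime (13 :: nat)" by simp
  note r = coeff_recursion_split[OF this, of 3 2 1]
  show "coeffA 13 = 0" "coeffB 13 = 10"
    using r coeff_1 by (simp_all add: leg5_def)
qed

theorem theorem4p15:
  fixes A B :: "nat \<Rightarrow> int"
  assumes "fps_X * euler_f 4 * euler_f 20 = Abs_fps A"
    and "fps_X * euler_f 4 ^ 6 = Abs_fps B"
  shows "{n. [B n = 0] (mod 25)} \<subset> {n. [A n = 0] (mod 25)}"
proof
  have A: "A n = coeffA n" and B: "B n = coeffB n" for n
    by (simp_all only: coeffA_def coeffB_def assms fps_nth_Abs_fps)
  show "{n. [B n = 0] (mod 25)} \<subseteq> {n. [A n = 0] (mod 25)}"
  proof (intro subsetI CollectI, unfold mem_Collect_eq cong_0_iff)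
    fix n assume "25 dvd B n"
    show "25 dvd A n"
    proof (cases "n = 0")
      \<comment> \<open>The induction covers positive n only; the coefficient at 0 vanishes because
        of the factor q.\<close>
      case True
      then show ?thesis by (simp add: A coeffA_def mult.assoc)
    next
      case False
      then have "A n = 0 \<or> unit_multiple (A n) (B n)"
        unfolding A B using unit_multiple_of_local_data[OF coeff_1 coeff_local_data] by simp
      then show ?thesis using \<open>25 dvd B n\<close> unit_multiple_dvd by auto
    qed
  qed
  have "13 \<in> {n. [A n = 0] (mod 25)}" "13 \<notin> {n. [B n = 0] (mod 25)}"
    by (simp_all add: A B coeffA_13 coeffB_13 cong_0_iff)
  then show "{n. [B n = 0] (mod 25)} \<noteq> {n. [A n = 0] (mod 25)}" by blast
qed

end
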